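(* Let $X$ be a smooth projective variety with $\mathrm{Pic}(X)\cong\mathbb{Z}^r$ and finitely generated Cox ring, with a presentation $R/I\cong\mathrm{Cox}(X)$, $R=k[x_1,\dots,x_n]$, as in the context. For every divisor $D=m_1D_1+\dots+m_rD_r$, the sequence $(\mathbb{A}(D),d)$ is a complex of $k$-vector spaces, and for every $i$ $$b_{i,D}(\mathrm{Cox}(X))=\dim_k H_i(\mathbb{A}(D)).$$
   Context: Let $k$ be an algebraically closed field and $X$ a smooth projective variety over $k$ with $\mathrm{Pic}(X)\cong\mathbb{Z}^r$. Fix effective divisors $D_1,\dots,D_r$ whose classes form a basis of $\mathrm{Pic}(X)$; elements $(m_1,\dots,m_r)\in\mathbb{Z}^r\cong\mathrm{Pic}(X)$ are identified with divisors $m_1D_1+\dots+m_rD_r$. The Cox ring is $\mathrm{Cox}(X)=\bigoplus_{(m_1,\dots,m_r)\in\mathbb{Z}^r}H^0(X,m_1D_1+\dots+m_rD_r)$ with multiplication induced by that of $k(X)$. Assume it is a finitely generated $k$-algebra and fix a presentation $k[x_1,\dots,x_n]/I\cong\mathrm{Cox}(X)$ in which the images of the variables (denoted again by $x_i$) are irreducible homogeneous elements of $\mathrm{Cox}(X)$. Let $C_i\in\mathbb{Z}^r$ be the degree of the image of $x_i$; grade $R=k[x_1,\dots,x_n]$ by $\mathrm{Pic}(X)$ with $\deg x_i=C_i$. Then $I$ is $\mathrm{Pic}(X)$-homogeneous and prime. Finitely generated $\mathrm{Pic}(X)$-graded $R$-modules have a unique minimal $\mathrm{Pic}(X)$-graded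 free resolution; $b_{i,D}(\mathrm{Cox}(X))$ denotes the multiplicity of $R(-D)$ in the $i$-th step of the minimal graded free resolution of the $R$-module $\mathrm{Cox}(X)$. For a divisor $D=m_1D_1+\dots+m_rD_r$, $\mathbb{A}(D)$ is the sequence with $\mathbb{A}_0=H^0(X,D)$ and, for $1\leq j\leq n$, $$\mathbb{A}_j=\bigoplus_{1\leq i_1<\dots<i_j\leq n}H^0(X,D-C_{i_1}-\dots-C_{i_j}),$$ where an element $s$ of the summand indexed by $i_1<\dots<i_j$ is written $s\,u_{i_1\dots i_j}$ (and $u_0$ marks the summand $\mathbb{A}_0$). The differentials $d_j:\mathbb{A}_j\to\mathbb{A}_{j-1}$ are given by $d_1(s\,u_i)=s x_i\,u_0$ and $d_j(s\,u_{i_1\dots i_j})=\sum_{t=1}^j(-1)^{t+1}s\,x_{i_t}\,u_{i_1\dots i_{t-1}\widehat{i_t}i_{t+1}\dots i_j}$ (the index $i_t$ omitted). *)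

theory Defs
  imports
    "HOL-Library.Poly_Mapping"
    "HOL-Library.Extended_Nat"
    "HOL-Computational_Algebra.Polynomial"
    "HOL-Algebra.Ring_Divisibility"
    "HOL-Algebra.Ideal_Product"
begin

section \<open>Multivariate polynomials\<close>

text \<open>Exponent vectors are finitely supported functions to the naturals, polynomials are finitely
  supported functions from exponent vectors to coefficients, with the convolution product
  of \<^theory>\<open>HOL-Library.Poly_Mapping\<close>.\<close>

type_synonym ('v, 'k) mpoly = "('v \<Rightarrow>\<^sub>0 nat) \<Rightarrow>\<^sub>0 'k"

abbreviation keys :: "('a \<Rightarrow>\<^sub>0 'b::zero) \<Rightarrow> 'a set" where "keys \<equiv> Poly_Mapping.keys"

abbreviation lookup :: "('a \<Rightarrow>\<^sub>0 'b::zero) \<Rightarrow> 'a \<Rightarrow> 'b" where "lookup \<equiv> Poly_Mapping.lookup"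

definition mpoly_eval ::
  "('k::zero \<Rightarrow> 'b::comm_ring_1) \<Rightarrow> ('v \<Rightarrow> 'b) \<Rightarrow> ('v, 'k) mpoly \<Rightarrow> 'b" where
  "mpoly_eval c a p = (\<Sum>m\<in>keys p. c (lookup p m) * (\<Prod>v\<in>keys m. a v ^ lookup m v))"

definition homogeneous :: "nat \<Rightarrow> ('v, 'k::zero) mpoly \<Rightarrow> bool" where
  "homogeneous d p \<longleftrightarrow> (\<forall>m\<in>keys p. (\<Sum>v\<in>keys m. lookup m v) = d)"

text \<open>A subring of a type class ring, as a structure of HOL-Algebra.\<close>

definition subring_of :: "'a::comm_ring_1 set \<Rightarrow> 'a ring" where
  "subring_of A = \<lparr>carrier = A, mult = (*), one = 1, zero = 0, add = (+)\<rparr>"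


section \<open>Dimensions\<close>

text \<open>The set \<open>B\<close> maps bijectively onto a basis of the quotient space \<open>V / W\<close>.\<close>

definition basis_modulo ::
  "('k::field \<Rightarrow> 'v::ab_group_add \<Rightarrow> 'v) \<Rightarrow> 'v set \<Rightarrow> 'v set \<Rightarrow> 'v set \<Rightarrow> bool" where
  "basis_modulo scale V W B \<longleftrightarrow> finite B \<and> B \<subseteq> V \<and>
     (\<forall>v\<in>V. \<exists>!c. (\<forall>b. b \<notin> B \<longrightarrow> c b = 0) \<and> v - (\<Sum>b\<in>B. scale (c b) b) \<in> W)"

definition quotient_dim ::
  "('k::field \<Rightarrow> 'v::ab_group_add \<Rightarrow> 'v) \<Rightarrow> 'v set \<Rightarrow> 'v set \<Rightarrow> enat" where
  "quotient_dim scale V W =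
     (if \<exists>B. basis_modulo scale V W B
      then enat (THE d. \<exists>B. basis_modulo scale V W B \<and> card B = d) else \<infinity>)"

definition krull_dim :: "'a ring \<Rightarrow> enat" where
  "krull_dim A = Sup {enat d | d. \<exists>P :: nat \<Rightarrow> 'a set.
     (\<forall>i\<le>d. primeideal (P i) A) \<and> (\<forall>i<d. P i \<subset> P (Suc i))}"


section \<open>Projective varieties\<close>

text \<open>Points of projective space with coordinates indexed by the finite type \<open>'v\<close> are given by their
  nonzero vectors of homogeneous coordinates, so that a subvariety is represented by the punctured
  affine cone over it. All notions below depend only on the point and not on the vector.\<close>

definition zero_locus :: "('v, 'k::field) mpoly set \<Rightarrow> ('v \<Rightarrow> 'k) set" where
  "zero_locus T = {a. (\<exists>v. a v \<noteq> 0) \<and> (\<forall>p\<in>T. mpoly_eval id a p = 0)}"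

definition zariski_closed :: "('v \<Rightarrow> 'k::field) set \<Rightarrow> bool" where
  "zariski_closed Z \<longleftrightarrow> (\<exists>T. (\<forall>p\<in>T. \<exists>d. homogeneous d p) \<and> Z = zero_locus T)"

definition projective_variety :: "('v::finite \<Rightarrow> 'k::alg_closed_field) set \<Rightarrow> bool" where
  "projective_variety X \<longleftrightarrow> zariski_closed X \<and> X \<noteq> {} \<and>
     (\<forall>Y Z. zariski_closed Y \<and> zariski_closed Z \<and> X \<subseteq> Y \<union> Z \<longrightarrow> X \<subseteq> Y \<or> X \<subseteq> Z)"

text \<open>Homogeneous coordinates \<open>\<xi>\<close> of a generic point of \<open>X\<close> in an extension field \<open>'K\<close> of \<open>k\<close>:
  the forms vanishing at \<open>\<xi>\<close> are exactly those vanishing on \<open>X\<close>. Then \<open>p / q \<mapsto> p(\<xi>) / q(\<xi>)\<close>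
  identifies the field of rational functions \<open>k(X)\<close>, i.e. fractions of forms of equal degree modulo
  the homogeneous ideal of \<open>X\<close>, with the subfield \<open>function_field\<close> of \<open>'K\<close>. A possible choice for
  \<open>'K\<close> is \<open>k(X)\<close> itself, with \<open>\<xi> v\<close> the class of \<open>x\<^sub>v / x\<^sub>w\<close> for a fixed coordinate \<open>x\<^sub>w\<close> that does
  not vanish identically on \<open>X\<close>.\<close>

definition field_embedding :: "('k::field \<Rightarrow> 'K::field) \<Rightarrow> bool" where
  "field_embedding \<iota> \<longleftrightarrow>
     \<iota> 1 = 1 \<and> (\<forall>a b. \<iota> (a + b) = \<iota> a + \<iota> b) \<and> (\<forall>a b. \<iota> (a * b) = \<iota> a * \<iota> b)"

definition generic_point ::
  "('v::finite \<Rightarrow> 'k::alg_closed_field) set \<Rightarrow> ('k \<Rightarrow> 'K::field) \<Rightarrow> ('v \<Rightarrow> 'K) \<Rightarrow> bool" where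
  "generic_point X \<iota> \<xi> \<longleftrightarrow> field_embedding \<iota> \<and>
     (\<forall>d p. homogeneous d p \<longrightarrow> (mpoly_eval \<iota> \<xi> p = 0 \<longleftrightarrow> (\<forall>a\<in>X. mpoly_eval id a p = 0)))"

definition function_field ::
  "('k::alg_closed_field \<Rightarrow> 'K::field) \<Rightarrow> ('v::finite \<Rightarrow> 'K) \<Rightarrow> 'K set" where
  "function_field \<iota> \<xi> = {mpoly_eval \<iota> \<xi> p / mpoly_eval \<iota> \<xi> q | p q.
     (\<exists>d. homogeneous d p \<and> homogeneous d q) \<and> mpoly_eval \<iota> \<xi> q \<noteq> 0}"

text \<open>For \<open>a\<close> in \<open>X\<close> the denominators below do not vanish at \<open>\<xi>\<close>, because they do not vanish on \<open>X\<close>.\<close>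

definition local_ring ::
  "('k::alg_closed_field \<Rightarrow> 'K::field) \<Rightarrow> ('v::finite \<Rightarrow> 'K) \<Rightarrow> ('v \<Rightarrow> 'k) \<Rightarrow> 'K set" where
  "local_ring \<iota> \<xi> a = {mpoly_eval \<iota> \<xi> p / mpoly_eval \<iota> \<xi> q | p q.
     (\<exists>d. homogeneous d p \<and> homogeneous d q) \<and> mpoly_eval id a q \<noteq> 0}"

definition local_max_ideal ::
  "('k::alg_closed_field \<Rightarrow> 'K::field) \<Rightarrow> ('v::finite \<Rightarrow> 'K) \<Rightarrow> ('v \<Rightarrow> 'k) \<Rightarrow> 'K set" where
  "local_max_ideal \<iota> \<xi> a = {mpoly_eval \<iota> \<xi> p / mpoly_eval \<iota> \<xi> q | p q.
     (\<exists>d. homogeneous d p \<and> homogeneous d q) \<and> mpoly_eval id a p = 0 \<and> mpoly_eval id a q \<noteq> 0}"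

definition local_units ::
  "('k::alg_closed_field \<Rightarrow> 'K::field) \<Rightarrow> ('v::finite \<Rightarrow> 'K) \<Rightarrow> ('v \<Rightarrow> 'k) \<Rightarrow> 'K set" where
  "local_units \<iota> \<xi> a = Units (subring_of (local_ring \<iota> \<xi> a))"

text \<open>All local rings are regular: \<open>dim \<mm> / \<mm>\<^sup>2\<close> equals the Krull dimension. The residue fields
  are \<open>k\<close>, and over the algebraically closed field \<open>k\<close> this is equivalent to smoothness.\<close>

definition smooth_variety ::
  "('v::finite \<Rightarrow> 'k::alg_closed_field) set \<Rightarrow> ('k \<Rightarrow> 'K::field) \<Rightarrow> ('v \<Rightarrow> 'K) \<Rightarrow> bool" where
  "smooth_variety X \<iota> \<xi> \<longleftrightarrow> (\<forall>a\<in>X.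
     let A = subring_of (local_ring \<iota> \<xi> a); \<mm> = local_max_ideal \<iota> \<xi> a
     in quotient_dim (\<lambda>c f. \<iota> c * f) \<mm> (ideal_prod A \<mm> \<mm>) = krull_dim A)"


section \<open>Divisors and the Picard group\<close>

text \<open>A Cartier divisor is represented by a choice of a local equation \<open>E a\<close> at every point \<open>a\<close>;
  the local equation at \<open>a\<close> has to be a local equation on a whole neighbourhood \<open>X - Z\<close> of \<open>a\<close>. Local
  equations matter only up to units of the local rings, and the sum of divisors corresponds to
  the product of local equations.\<close>

definition cartier_divisor ::
  "('v::finite \<Rightarrow> 'k::alg_closed_field) set \<Rightarrow> ('k \<Rightarrow> 'K::field) \<Rightarrow> ('v \<Rightarrow> 'K)
    \<Rightarrow> (('v \<Rightarrow> 'k) \<Rightarrow> 'K) \<Rightarrow> bool" where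
  "cartier_divisor X \<iota> \<xi> E \<longleftrightarrow>
     (\<forall>a\<in>X. E a \<in> function_field \<iota> \<xi> - {0}) \<and>
     (\<forall>a\<in>X. \<exists>Z. zariski_closed Z \<and> a \<notin> Z \<and> (\<forall>b\<in>X - Z. E b / E a \<in> local_units \<iota> \<xi> b))"

definition effective_divisor ::
  "('v::finite \<Rightarrow> 'k::alg_closed_field) set \<Rightarrow> ('k \<Rightarrow> 'K::field) \<Rightarrow> ('v \<Rightarrow> 'K)
    \<Rightarrow> (('v \<Rightarrow> 'k) \<Rightarrow> 'K) \<Rightarrow> bool" where
  "effective_divisor X \<iota> \<xi> E \<longleftrightarrow> cartier_divisor X \<iota> \<xi> E \<and> (\<forall>a\<in>X. E a \<in> local_ring \<iota> \<xi> a)"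

definition linearly_equivalent ::
  "('v::finite \<Rightarrow> 'k::alg_closed_field) set \<Rightarrow> ('k \<Rightarrow> 'K::field) \<Rightarrow> ('v \<Rightarrow> 'K)
    \<Rightarrow> (('v \<Rightarrow> 'k) \<Rightarrow> 'K) \<Rightarrow> (('v \<Rightarrow> 'k) \<Rightarrow> 'K) \<Rightarrow> bool" where
  "linearly_equivalent X \<iota> \<xi> E F \<longleftrightarrow>
     (\<exists>h\<in>function_field \<iota> \<xi> - {0}. \<forall>a\<in>X. E a / (F a * h) \<in> local_units \<iota> \<xi> a)"

text \<open>The space \<open>H\<^sup>0(X, E)\<close> of rational functions \<open>s\<close> with \<open>s = 0\<close> or \<open>div s + E \<ge> 0\<close>.\<close>

definition global_sections ::
  "('v::finite \<Rightarrow> 'k::alg_closed_field) set \<Rightarrow> ('k \<Rightarrow> 'K::field) \<Rightarrow> ('v \<Rightarrow> 'K)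
    \<Rightarrow> (('v \<Rightarrow> 'k) \<Rightarrow> 'K) \<Rightarrow> 'K set" where
  "global_sections X \<iota> \<xi> E = {s \<in> function_field \<iota> \<xi>. \<forall>a\<in>X. s * E a \<in> local_ring \<iota> \<xi> a}"

text \<open>The group \<open>\<int>\<^sup>r\<close>, as a subgroup of the finitely supported integer sequences.\<close>

definition degree_group :: "nat \<Rightarrow> (nat \<Rightarrow>\<^sub>0 int) set" where
  "degree_group r = {m. keys m \<subseteq> {..<r}}"

text \<open>The divisor \<open>m\<^sub>0 D\<^sub>0 + \<dots> + m\<^sub>r\<^sub>-\<^sub>1 D\<^sub>r\<^sub>-\<^sub>1\<close>.\<close>

definition divisor_comb ::
  "nat \<Rightarrow> (nat \<Rightarrow> ('v \<Rightarrow> 'k) \<Rightarrow> 'K::field) \<Rightarrow> (nat \<Rightarrow>\<^sub>0 int) \<Rightarrow> ('v \<Rightarrow> 'k) \<Rightarrow> 'K" where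
  "divisor_comb r D m = (\<lambda>a. \<Prod>i<r. D i a powi lookup m i)"

text \<open>On the integral scheme \<open>X\<close> the Picard group is the group of Cartier divisors modulo linear
  equivalence. The classes of the \<open>D i\<close> form a basis if every class is a unique integral
  combination of them; this contains \<open>Pic X \<cong> \<int>\<^sup>r\<close>.\<close>

definition pic_basis ::
  "('v::finite \<Rightarrow> 'k::alg_closed_field) set \<Rightarrow> ('k \<Rightarrow> 'K::field) \<Rightarrow> ('v \<Rightarrow> 'K)
    \<Rightarrow> nat \<Rightarrow> (nat \<Rightarrow> ('v \<Rightarrow> 'k) \<Rightarrow> 'K) \<Rightarrow> bool" where
  "pic_basis X \<iota> \<xi> r D \<longleftrightarrow> (\<forall>i<r. cartier_divisor X \<iota> \<xi> (D i)) \<and>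
     (\<forall>E. cartier_divisor X \<iota> \<xi> E \<longrightarrow>
        (\<exists>!m. m \<in> degree_group r \<and> linearly_equivalent X \<iota> \<xi> E (divisor_comb r D m)))"


section \<open>The Cox ring and its presentations\<close>

text \<open>The Cox ring is a subring of the group ring of \<open>\<int>\<^sup>r\<close> over \<open>'K\<close>: the element
  \<open>Poly_Mapping.single m s\<close> is the section \<open>s\<close> placed in degree \<open>m\<close>.\<close>

definition cox_piece ::
  "('v::finite \<Rightarrow> 'k::alg_closed_field) set \<Rightarrow> ('k \<Rightarrow> 'K::field) \<Rightarrow> ('v \<Rightarrow> 'K)
    \<Rightarrow> nat \<Rightarrow> (nat \<Rightarrow> ('v \<Rightarrow> 'k) \<Rightarrow> 'K) \<Rightarrow> (nat \<Rightarrow>\<^sub>0 int) \<Rightarrow> ((nat \<Rightarrow>\<^sub>0 int) \<Rightarrow>\<^sub>0 'K) set" where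
  "cox_piece X \<iota> \<xi> r D m =
     {Poly_Mapping.single m s | s. s \<in> global_sections X \<iota> \<xi> (divisor_comb r D m)}"

definition cox_ring ::
  "('v::finite \<Rightarrow> 'k::alg_closed_field) set \<Rightarrow> ('k \<Rightarrow> 'K::field) \<Rightarrow> ('v \<Rightarrow> 'K)
    \<Rightarrow> nat \<Rightarrow> (nat \<Rightarrow> ('v \<Rightarrow> 'k) \<Rightarrow> 'K) \<Rightarrow> ((nat \<Rightarrow>\<^sub>0 int) \<Rightarrow>\<^sub>0 'K) set" where
  "cox_ring X \<iota> \<xi> r D = {f. keys f \<subseteq> degree_group r \<and>
     (\<forall>m\<in>degree_group r. lookup f m \<in> global_sections X \<iota> \<xi> (divisor_comb r D m))}"

definition poly_ring :: "nat \<Rightarrow> (nat, 'k::comm_ring_1) mpoly set" where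
  "poly_ring n = {p. \<forall>m\<in>keys p. keys m \<subseteq> {..<n}}"

text \<open>The homomorphism of \<open>k\<close>-algebras from \<open>R\<close> sending the \<open>i\<close>-th variable to the section \<open>x i\<close> in
  degree \<open>C i\<close>.\<close>

definition cox_map ::
  "('k::field \<Rightarrow> 'K::field) \<Rightarrow> (nat \<Rightarrow> nat \<Rightarrow>\<^sub>0 int) \<Rightarrow> (nat \<Rightarrow> 'K)
    \<Rightarrow> (nat, 'k) mpoly \<Rightarrow> (nat \<Rightarrow>\<^sub>0 int) \<Rightarrow>\<^sub>0 'K" where
  "cox_map \<iota> C x =
     mpoly_eval (\<lambda>c. Poly_Mapping.single 0 (\<iota> c)) (\<lambda>i. Poly_Mapping.single (C i) (x i))"

text \<open>The ideal \<open>I\<close> of the presentation is the kernel of the surjection \<open>cox_map \<iota> C x\<close>.\<close>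

definition cox_presentation ::
  "('v::finite \<Rightarrow> 'k::alg_closed_field) set \<Rightarrow> ('k \<Rightarrow> 'K::field) \<Rightarrow> ('v \<Rightarrow> 'K)
    \<Rightarrow> nat \<Rightarrow> (nat \<Rightarrow> ('v \<Rightarrow> 'k) \<Rightarrow> 'K)
    \<Rightarrow> nat \<Rightarrow> (nat \<Rightarrow> nat \<Rightarrow>\<^sub>0 int) \<Rightarrow> (nat \<Rightarrow> 'K) \<Rightarrow> bool" where
  "cox_presentation X \<iota> \<xi> r D n C x \<longleftrightarrow>
     (\<forall>i<n. C i \<in> degree_group r \<and>
        Poly_Mapping.single (C i) (x i) \<in> cox_piece X \<iota> \<xi> r D (C i) \<and>
        ring_irreducible\<^bsub>subring_of (cox_ring X \<iota> \<xi> r D)\<^esub> (Poly_Mapping.single (C i) (x i))) \<and>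
     cox_map \<iota> C x ` poly_ring n = cox_ring X \<iota> \<xi> r D"


section \<open>Minimal graded free resolutions\<close>

definition monom_degree :: "(nat \<Rightarrow> nat \<Rightarrow>\<^sub>0 int) \<Rightarrow> (nat \<Rightarrow>\<^sub>0 nat) \<Rightarrow> nat \<Rightarrow>\<^sub>0 int" where
  "monom_degree C m = (\<Sum>i\<in>keys m. frag_cmul (int (lookup m i)) (C i))"

definition poly_piece ::
  "nat \<Rightarrow> (nat \<Rightarrow> nat \<Rightarrow>\<^sub>0 int) \<Rightarrow> (nat \<Rightarrow>\<^sub>0 int) \<Rightarrow> (nat, 'k::comm_ring_1) mpoly set" where
  "poly_piece n C d = {p \<in> poly_ring n. \<forall>m\<in>keys p. monom_degree C m = d}"

text \<open>The ideal generated by the variables.\<close>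

definition irrelevant_ideal :: "nat \<Rightarrow> (nat, 'k::comm_ring_1) mpoly set" where
  "irrelevant_ideal n = {p \<in> poly_ring n. lookup p 0 = 0}"

text \<open>The module \<open>R(-e 0) \<oplus> \<dots> \<oplus> R(-e (b - 1))\<close> and its pieces of degree \<open>d\<close>.\<close>

definition free_module :: "nat \<Rightarrow> nat \<Rightarrow> (nat \<Rightarrow>\<^sub>0 (nat, 'k::comm_ring_1) mpoly) set" where
  "free_module n b = {f. keys f \<subseteq> {..<b} \<and> (\<forall>j. lookup f j \<in> poly_ring n)}"

definition free_piece ::
  "nat \<Rightarrow> (nat \<Rightarrow> nat \<Rightarrow>\<^sub>0 int) \<Rightarrow> nat \<Rightarrow> (nat \<Rightarrow> nat \<Rightarrow>\<^sub>0 int) \<Rightarrow> (nat \<Rightarrow>\<^sub>0 int)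
    \<Rightarrow> (nat \<Rightarrow>\<^sub>0 (nat, 'k::comm_ring_1) mpoly) set" where
  "free_piece n C b e d = {f \<in> free_module n b. \<forall>j<b. lookup f j \<in> poly_piece n C (d - e j)}"

definition linear_map_on ::
  "'r set \<Rightarrow> ('r \<Rightarrow> 'a::ab_group_add \<Rightarrow> 'a) \<Rightarrow> ('r \<Rightarrow> 'b::ab_group_add \<Rightarrow> 'b) \<Rightarrow> 'a set
    \<Rightarrow> ('a \<Rightarrow> 'b) \<Rightarrow> bool" where
  "linear_map_on R s t M h \<longleftrightarrow>
     (\<forall>f\<in>M. \<forall>g\<in>M. h (f + g) = h f + h g) \<and> (\<forall>p\<in>R. \<forall>f\<in>M. h (s p f) = t p (h f))"

text \<open>Minimal graded free resolutions of a graded \<open>R\<close>-module \<open>M\<close> with scalar multiplication \<open>act\<close> and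
  pieces \<open>Mpiece d\<close> for \<open>d\<close> in \<open>\<int>\<^sup>r\<close>. The \<open>i\<close>-th free module is the sum of the \<open>R(-shift i j)\<close> for
  \<open>j < rank i\<close>, the map \<open>diff i\<close> goes from step \<open>i + 1\<close> to step \<open>i\<close>, and \<open>aug\<close> from step \<open>0\<close> to \<open>M\<close>.\<close>

definition minimal_graded_free_resolution ::
  "nat \<Rightarrow> nat \<Rightarrow> (nat \<Rightarrow> nat \<Rightarrow>\<^sub>0 int)
    \<Rightarrow> 'm::ab_group_add set \<Rightarrow> ((nat, 'k::field) mpoly \<Rightarrow> 'm \<Rightarrow> 'm) \<Rightarrow> ((nat \<Rightarrow>\<^sub>0 int) \<Rightarrow> 'm set)
    \<Rightarrow> (nat \<Rightarrow> nat) \<Rightarrow> (nat \<Rightarrow> nat \<Rightarrow> nat \<Rightarrow>\<^sub>0 int)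
    \<Rightarrow> (nat \<Rightarrow> (nat \<Rightarrow>\<^sub>0 (nat, 'k) mpoly) \<Rightarrow> (nat \<Rightarrow>\<^sub>0 (nat, 'k) mpoly))
    \<Rightarrow> ((nat \<Rightarrow>\<^sub>0 (nat, 'k) mpoly) \<Rightarrow> 'm) \<Rightarrow> bool" where
  "minimal_graded_free_resolution r n C M act Mpiece rank shift diff aug \<longleftrightarrow>
     (let F = (\<lambda>i. free_module n (rank i));
          Fpiece = (\<lambda>i. free_piece n C (rank i) (shift i));
          scale = (\<lambda>p. Poly_Mapping.map ((*) p))
      in (\<forall>i. \<forall>j<rank i. shift i j \<in> degree_group r) \<and>
         linear_map_on (poly_ring n) scale act (F 0) aug \<and>
         (\<forall>d\<in>degree_group r. aug ` Fpiece 0 d \<subseteq> Mpiece d) \<and>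
         (\<forall>i. linear_map_on (poly_ring n) scale scale (F (Suc i)) (diff i)) \<and>
         (\<forall>i. \<forall>d\<in>degree_group r. diff i ` Fpiece (Suc i) d \<subseteq> Fpiece i d) \<and>
         aug ` F 0 = M \<and>
         {f \<in> F 0. aug f = 0} = diff 0 ` F 1 \<and>
         (\<forall>i. {f \<in> F (Suc i). diff i f = 0} = diff (Suc i) ` F (Suc (Suc i))) \<and>
         (\<forall>i. \<forall>f\<in>F (Suc i). \<forall>j. lookup (diff i f) j \<in> irrelevant_ideal n))"

text \<open>The multiplicity of \<open>R(-d)\<close> in the \<open>i\<close>-th step.\<close>

definition multiplicity_in_step ::
  "(nat \<Rightarrow> nat) \<Rightarrow> (nat \<Rightarrow> nat \<Rightarrow> nat \<Rightarrow>\<^sub>0 int) \<Rightarrow> nat \<Rightarrow> (nat \<Rightarrow>\<^sub>0 int) \<Rightarrow> nat" where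
  "multiplicity_in_step rank shift i d = card {j. j < rank i \<and> shift i j = d}"


section \<open>Complexes of vector spaces and the complex of sections\<close>

text \<open>Nonnegatively graded complexes whose terms are subspaces \<open>A j\<close> of one ambient space, with
  differentials the restrictions \<open>A j \<rightarrow> A (j - 1)\<close> of one endomorphism \<open>d\<close>.\<close>

definition vs_complex ::
  "('k::field \<Rightarrow> 'a::ab_group_add \<Rightarrow> 'a) \<Rightarrow> (nat \<Rightarrow> 'a set) \<Rightarrow> ('a \<Rightarrow> 'a) \<Rightarrow> bool" where
  "vs_complex scale A d \<longleftrightarrow>
     (\<forall>j. module.subspace scale (A j)) \<and> Vector_Spaces.linear scale scale d \<and>
     d ` A 0 = {0} \<and> (\<forall>j. d ` A (Suc j) \<subseteq> A j) \<and> (\<forall>j. \<forall>a\<in>A j. d (d a) = 0)"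

definition homology_dim ::
  "('k::field \<Rightarrow> 'a::ab_group_add \<Rightarrow> 'a) \<Rightarrow> (nat \<Rightarrow> 'a set) \<Rightarrow> ('a \<Rightarrow> 'a) \<Rightarrow> nat \<Rightarrow> enat" where
  "homology_dim scale A d i = quotient_dim scale {a \<in> A i. d a = 0} (d ` A (Suc i))"

text \<open>A sequence \<open>i\<^sub>1 < \<dots> < i\<^sub>j\<close> is encoded by the set \<open>S\<close> of its members, and \<open>s u\<^sub>S\<close> is
  \<open>Poly_Mapping.single S s\<close>.\<close>

definition section_complex ::
  "('v::finite \<Rightarrow> 'k::alg_closed_field) set \<Rightarrow> ('k \<Rightarrow> 'K::field) \<Rightarrow> ('v \<Rightarrow> 'K)
    \<Rightarrow> nat \<Rightarrow> (nat \<Rightarrow> ('v \<Rightarrow> 'k) \<Rightarrow> 'K) \<Rightarrow> nat \<Rightarrow> (nat \<Rightarrow> nat \<Rightarrow>\<^sub>0 int) \<Rightarrow> (nat \<Rightarrow>\<^sub>0 int)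
    \<Rightarrow> nat \<Rightarrow> (nat set \<Rightarrow>\<^sub>0 'K) set" where
  "section_complex X \<iota> \<xi> r D n C m j =
     {a. (\<forall>S\<in>keys a. S \<subseteq> {..<n} \<and> card S = j \<and>
            lookup a S \<in> global_sections X \<iota> \<xi> (divisor_comb r D (m - (\<Sum>i\<in>S. C i))))}"

definition section_scale :: "('k::field \<Rightarrow> 'K::field) \<Rightarrow> 'k \<Rightarrow> (nat set \<Rightarrow>\<^sub>0 'K) \<Rightarrow> (nat set \<Rightarrow>\<^sub>0 'K)" where
  "section_scale \<iota> c = Poly_Mapping.map ((*) (\<iota> c))"

text \<open>The position of \<open>i\<close> in the sequence encoded by \<open>S\<close>, counted from 1, is \<open>card {l \<in> S. l \<le> i}\<close>.\<close>

definition section_diff :: "(nat \<Rightarrow> 'K::field) \<Rightarrow> (nat set \<Rightarrow>\<^sub>0 'K) \<Rightarrow> (nat set \<Rightarrow>\<^sub>0 'K)" where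
  "section_diff x a = (\<Sum>S\<in>keys a. \<Sum>i\<in>S. Poly_Mapping.single (S - {i})
     ((-1) ^ (card {l \<in> S. l \<le> i} + 1) * (lookup a S * x i)))"

end

theory Submission
  imports Defs "HOL-Library.Function_Algebras"
begin

text \<open>Both sides of the equation compute \<open>Tor\<^sub>i(Cox(X), k)\<close> over \<open>R\<close> in degree \<open>D\<close>. The complex \<open>\<bbbA>(D)\<close> is the part
  of degree \<open>D\<close> of the Koszul complex of the variables with coefficients in the Cox ring, and the Koszul
  complex resolves \<open>k = R / (x\<^sub>1, \<dots>, x\<^sub>n)\<close>. On the other hand, the differentials of a minimal free resolution
  \<open>F\<close> vanish modulo \<open>(x\<^sub>1, \<dots>, x\<^sub>n)\<close>, so that Tor is \<open>F\<^sub>i / (x\<^sub>1, \<dots>, x\<^sub>n) F\<^sub>i\<close>, which in degree \<open>D\<close> has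
  one basis element for each summand \<open>R(-D)\<close>.

  The comparison of the two is carried out by dimension shifting instead of derived functors. Let
  \<open>Z\<^sub>0 = Cox(X)\<close> and let \<open>Z\<^sub>i\<^sub>+\<^sub>1\<close> be the kernel of \<open>F\<^sub>i \<rightarrow> Z\<^sub>i\<close>. The exact sequences
  \<open>0 \<rightarrow> Z\<^sub>i\<^sub>+\<^sub>1 \<rightarrow> F\<^sub>i \<rightarrow> Z\<^sub>i \<rightarrow> 0\<close> induce exact sequences of Koszul complexes. Since the Koszul complex of
  \<open>F\<^sub>i\<close> is acyclic in positive degrees (\<open>koszul_acyclic\<close>), and since \<open>Z\<^sub>i\<^sub>+\<^sub>1\<close> is contained in
  \<open>(x\<^sub>1, \<dots>, x\<^sub>n) F\<^sub>i\<close> by minimality, the connecting homomorphisms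
  \<open>H\<^sub>j\<^sub>+\<^sub>1(Z\<^sub>i) \<rightarrow> H\<^sub>j(Z\<^sub>i\<^sub>+\<^sub>1)\<close> are isomorphisms for all \<open>j \<ge> 0\<close> (\<open>connecting_isomorphism\<close>). Hence
  \<open>H\<^sub>i(Cox(X)) \<cong> H\<^sub>0(Z\<^sub>i)\<close>, and by minimality once more
  \<open>H\<^sub>0(Z\<^sub>i) \<cong> H\<^sub>0(F\<^sub>i) = F\<^sub>i / (x\<^sub>1, \<dots>, x\<^sub>n) F\<^sub>i\<close> (\<open>augmentation_isomorphism\<close>).

  The acyclicity rests on a contracting homotopy that divides a monomial by its least variable
  (\<open>homotopy_identity\<close>). It involves no division by integers and so works in every characteristic,
  and it is homogeneous for the grading by \<open>\<int>\<^sup>r\<close>.\<close>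


section \<open>Quotient spaces and linear correspondences\<close>

text \<open>An additive relation inducing an isomorphism \<open>V / W \<cong> V' / W'\<close>. Connecting homomorphisms are
  defined by choosing a lift; as relations they need no choice, and they compose without any
  well-definedness argument.\<close>

definition linear_correspondence ::
  "('k::field \<Rightarrow> 'a::ab_group_add \<Rightarrow> 'a) \<Rightarrow> 'a set \<Rightarrow> 'a set
    \<Rightarrow> ('k \<Rightarrow> 'b::ab_group_add \<Rightarrow> 'b) \<Rightarrow> 'b set \<Rightarrow> 'b set \<Rightarrow> ('a \<Rightarrow> 'b \<Rightarrow> bool) \<Rightarrow> bool" where
  "linear_correspondence s V W t V' W' \<rho> \<longleftrightarrow>
     (\<forall>v v'. \<rho> v v' \<longrightarrow> v \<in> V \<and> v' \<in> V' \<and> (v \<in> W \<longleftrightarrow> v' \<in> W')) \<and>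
     (\<forall>v v' w w'. \<rho> v v' \<longrightarrow> \<rho> w w' \<longrightarrow> \<rho> (v - w) (v' - w')) \<and>
     (\<forall>c v v'. \<rho> v v' \<longrightarrow> \<rho> (s c v) (t c v')) \<and>
     (\<forall>v\<in>V. \<exists>v'. \<rho> v v') \<and> (\<forall>v'\<in>V'. \<exists>v. \<rho> v v')"

definition isomorphic_quotients ::
  "('k::field \<Rightarrow> 'a::ab_group_add \<Rightarrow> 'a) \<Rightarrow> 'a set \<Rightarrow> 'a set
    \<Rightarrow> ('k \<Rightarrow> 'b::ab_group_add \<Rightarrow> 'b) \<Rightarrow> 'b set \<Rightarrow> 'b set \<Rightarrow> bool" where
  "isomorphic_quotients s V W t V' W' \<longleftrightarrow> (\<exists>\<rho>. linear_correspondence s V W t V' W' \<rho>)"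

lemma isomorphic_quotients_trans:
  assumes "isomorphic_quotients s V W t V' W'" and "isomorphic_quotients t V' W' u V'' W''"
  shows "isomorphic_quotients s V W u V'' W''"
proof -
  obtain \<rho> \<sigma> where \<rho>: "linear_correspondence s V W t V' W' \<rho>"
    and \<sigma>: "linear_correspondence t V' W' u V'' W'' \<sigma>"
    using assms unfolding isomorphic_quotients_def by blast
  have "linear_correspondence s V W u V'' W'' (\<lambda>v v''. \<exists>v'. \<rho> v v' \<and> \<sigma> v' v'')"
    unfolding linear_correspondence_def
  proof (intro conjI allI impI ballI; (elim exE conjE)?)
    fix v assume "v \<in> V"
    then obtain v' where v': "\<rho> v v'" using \<rho> unfolding linear_correspondence_def by meson
    then have "v' \<in> V'" using \<rho> unfolding linear_correspondence_def by meson
    then show "\<exists>v'' v'. \<rho> v v' \<and> \<sigma> v' v''"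
      using v' \<sigma> unfolding linear_correspondence_def by meson
  next
    fix v'' assume "v'' \<in> V''"
    then obtain v' where v': "\<sigma> v' v''" using \<sigma> unfolding linear_correspondence_def by meson
    then have "v' \<in> V'" using \<sigma> unfolding linear_correspondence_def by meson
    then show "\<exists>v v'. \<rho> v v' \<and> \<sigma> v' v''"
      using v' \<rho> unfolding linear_correspondence_def by meson
  qed (use \<rho> \<sigma> in \<open>unfold linear_correspondence_def, meson+\<close>)
  then show ?thesis unfolding isomorphic_quotients_def by blast
qed

lemma ex1_eqD: "\<exists>!x. P x \<Longrightarrow> P a \<Longrightarrow> P b \<Longrightarrow> a = b" by blast

lemma linear_correspondence_sum:
  assumes \<rho>: "linear_correspondence s V W t V' W' \<rho>" and ne: "V' \<noteq> {}"
    and "finite B" and "\<And>b. b \<in> B \<Longrightarrow> \<rho> (f b) (g b)"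
  shows "\<rho> (\<Sum>b\<in>B. s (c b) (f b)) (\<Sum>b\<in>B. t (c b) (g b))"
proof -
  have diff: "\<rho> (v - w) (v' - w')" if "\<rho> v v'" "\<rho> w w'" for v w v' w'
    using \<rho> that unfolding linear_correspondence_def by meson
  obtain v v' where "\<rho> v v'"
    using \<rho> ne unfolding linear_correspondence_def by blast
  then have zero: "\<rho> 0 0" using diff[of v v' v v'] by simp
  have add: "\<rho> (v + w) (v' + w')" if "\<rho> v v'" "\<rho> w w'" for v w v' w'
    using diff[OF that(1) diff[OF zero that(2)]] by simp
  show ?thesis using assms(3,4)
  proof (induction B rule: finite_induct)
    case (insert b B)
    have "\<rho> (s (c b) (f b)) (t (c b) (g b))"
      using \<rho> insert.prems[of b] unfolding linear_correspondence_def by blast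
    then show ?case using insert by (simp add: add)
  qed (simp add: zero)
qed

text \<open>Any choice of partners of the members of a basis is again a basis: a difference
  \<open>v - (\<Sum>b. c b b)\<close> and its partner lie in \<open>W\<close> and \<open>W'\<close> simultaneously, so that both quotients
  impose the same conditions on the coefficients.\<close>

lemma basis_modulo_pullback:
  assumes iso: "isomorphic_quotients s V W t V' W'" and bas: "basis_modulo t V' W' B'"
    and vs: "vector_space t" and W': "module.subspace t W'" and ne: "V' \<noteq> {}"
  shows "\<exists>B. basis_modulo s V W B \<and> card B = card B'"
proof -
  interpret vector_space t by (rule vs)
  obtain \<rho> where \<rho>: "linear_correspondence s V W t V' W' \<rho>"
    using iso unfolding isomorphic_quotients_def by blast
  have finB': "finite B'" and B'V': "B' \<subseteq> V'"
    and ex1: "\<And>v. v \<in> V' \<Longrightarrow> \<exists>!c. (\<forall>b. b \<notin> B' \<longrightarrow> c b = 0) \<and> v - (\<Sum>b\<in>B'. t (c b) b) \<in> W'"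
    using bas unfolding basis_modulo_def by auto
  have "\<forall>b\<in>B'. \<exists>v. \<rho> v b" using \<rho> B'V' unfolding linear_correspondence_def by blast
  then obtain g where g: "\<And>b. b \<in> B' \<Longrightarrow> \<rho> (g b) b" by metis
  have diff: "\<rho> (v - w) (v' - w')" if "\<rho> v v'" "\<rho> w w'" for v w v' w'
    using \<rho> that unfolding linear_correspondence_def by meson
  have mem: "v \<in> V \<and> v' \<in> V' \<and> (v \<in> W \<longleftrightarrow> v' \<in> W')" if "\<rho> v v'" for v v'
    using \<rho> that unfolding linear_correspondence_def by meson
  have zero_mem: "0 \<in> W'" using W' by (rule subspace_0)
  have inj: "inj_on g B'"
  proof (rule inj_onI)
    fix a b assume ab: "a \<in> B'" "b \<in> B'" "g a = g b"
    have "\<rho> (g a - g b) (a - b)" using g ab by (intro diff)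
    moreover have "\<rho> (g a - g a) (a - a)" using g ab by (intro diff)
    ultimately have "a - b \<in> W'" using mem[of 0] zero_mem ab by auto
    \<comment> \<open>The indicators of \<open>a\<close> and \<open>b\<close> both represent \<open>a\<close> modulo \<open>W'\<close>.\<close>
    let ?d = "\<lambda>e x. if x = e then 1 else (0::'a)"
    have sum: "(\<Sum>x\<in>B'. t (?d e x) x) = e" if "e \<in> B'" for e
    proof -
      have "(\<Sum>x\<in>B'. t (?d e x) x) = (\<Sum>x\<in>B'. if x = e then x else 0)"
        by (rule sum.cong) auto
      then show ?thesis using that finB' by simp
    qed
    have "a \<in> V'" using ab B'V' by blast
    have "?d a = ?d b"
    proof (rule ex1_eqD)
      show "\<exists>!c. (\<forall>b. b \<notin> B' \<longrightarrow> c b = 0) \<and> a - (\<Sum>b\<in>B'. t (c b) b) \<in> W'"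
        by (rule ex1[OF \<open>a \<in> V'\<close>])
    qed (use ab sum[of a] sum[of b] \<open>a - b \<in> W'\<close> zero_mem in auto)
    from fun_cong[OF this, of a] show "a = b" by (auto split: if_splits)
  qed
  have key: "v - (\<Sum>b\<in>g ` B'. s (c b) b) \<in> W \<longleftrightarrow> v' - (\<Sum>b\<in>B'. t (c (g b)) b) \<in> W'"
    if "\<rho> v v'" for v v' c
  proof -
    have "\<rho> (v - (\<Sum>b\<in>B'. s (c (g b)) (g b))) (v' - (\<Sum>b\<in>B'. t (c (g b)) b))"
      using that g finB' ne by (intro diff linear_correspondence_sum[OF \<rho>])
    then show ?thesis using mem by (auto simp: sum.reindex[OF inj])
  qed
  have "basis_modulo s V W (g ` B')"
    unfolding basis_modulo_def
  proof (intro conjI ballI)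
    show "finite (g ` B')" using finB' by simp
    show "g ` B' \<subseteq> V" using g mem by blast
    fix v assume "v \<in> V"
    then obtain v' where v': "\<rho> v v'" using \<rho> unfolding linear_correspondence_def by blast
    then have "v' \<in> V'" using mem by blast
    from ex1[OF this] obtain c' where c': "\<And>b. b \<notin> B' \<Longrightarrow> c' b = 0"
      "v' - (\<Sum>b\<in>B'. t (c' b) b) \<in> W'"
      and c'_unique: "\<And>e. (\<forall>b. b \<notin> B' \<longrightarrow> e b = 0) \<Longrightarrow> v' - (\<Sum>b\<in>B'. t (e b) b) \<in> W' \<Longrightarrow> e = c'"
      by blast
    define c where "c a = (if a \<in> g ` B' then c' (the_inv_into B' g a) else 0)" for a
    have cg: "c (g b) = c' b" if "b \<in> B'" for b
      using that inj by (simp add: c_def the_inv_into_f_f)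
    show "\<exists>!c. (\<forall>b. b \<notin> g ` B' \<longrightarrow> c b = 0) \<and> v - (\<Sum>b\<in>g ` B'. s (c b) b) \<in> W"
    proof (intro ex1I[of _ c] conjI)
      show "\<forall>b. b \<notin> g ` B' \<longrightarrow> c b = 0" by (simp add: c_def)
      show "v - (\<Sum>b\<in>g ` B'. s (c b) b) \<in> W"
        unfolding key[OF v'] using c'(2) by (simp add: cg cong: sum.cong)
      fix e assume e: "(\<forall>b. b \<notin> g ` B' \<longrightarrow> e b = 0) \<and> v - (\<Sum>b\<in>g ` B'. s (e b) b) \<in> W"
      have "(\<lambda>b. if b \<in> B' then e (g b) else 0) = c'"
        using e key[OF v', of e] by (intro c'_unique) (simp_all cong: sum.cong)
      then have "e (g b) = c (g b)" if "b \<in> B'" for b using that cg[of b] by (auto dest: fun_cong[of _ _ b])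
      then show "e = c" using e by (intro ext) (auto simp: c_def)
    qed
  qed
  then show ?thesis using card_image[OF inj] by blast
qed

text \<open>Reducing the elements of \<open>B\<close> modulo \<open>W\<close> to combinations of \<open>B'\<close> keeps them linearly independent,
  because a relation between the reductions is a relation modulo \<open>W\<close> between the elements. The Steinitz
  bound then applies inside the span of \<open>B'\<close>.\<close>

lemma basis_modulo_card_le:
  assumes vs: "vector_space s" and W: "module.subspace s W"
    and B: "basis_modulo s V W B" and B': "basis_modulo s V W B'"
  shows "card B \<le> card B'"
proof -
  interpret vector_space s by (rule vs)
  have "\<forall>v\<in>V. \<exists>c. v - (\<Sum>b\<in>B'. s (c b) b) \<in> W"
    using B' unfolding basis_modulo_def by blast
  then obtain c where c: "\<And>v. v \<in> V \<Longrightarrow> v - (\<Sum>b\<in>B'. s (c v b) b) \<in> W" by metis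
  define p where "p v = (\<Sum>b\<in>B'. s (c v b) b)" for v
  have BV: "B \<subseteq> V" and finB: "finite B" and finB': "finite B'"
    using B B' unfolding basis_modulo_def by auto
  have indep: "u b = 0" if eq: "(\<Sum>b\<in>B. s (u b) (p b)) = 0" and b: "b \<in> B" for u b
  proof -
    have "(\<Sum>b\<in>B. s (u b) (b - p b)) \<in> W"
      using c BV by (intro subspace_sum[OF W] subspace_scale[OF W]) (auto simp: p_def)
    \<comment> \<open>The relation between the reductions is thus a relation modulo \<open>W\<close>. Adding its coefficients to
      those of the basis vector \<open>b\<close> gives a second representation of \<open>b\<close>.\<close>
    then have mem: "(\<Sum>b\<in>B. s (u b) b) \<in> W"
      using eq by (simp add: scale_right_diff_distrib sum_subtractf)
    define u' where "u' x = (if x \<in> B then u x else 0)" for x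
    have "b - (\<Sum>x\<in>B. s ((if x = b then 1 else 0) + u' x) x) = - (\<Sum>b\<in>B. s (u b) b)"
    proof -
      have "(\<Sum>x\<in>B. s ((if x = b then 1 else 0) + u' x) x)
          = (\<Sum>x\<in>B. (if x = b then x else 0) + s (u x) x)"
        by (rule sum.cong) (auto simp: scale_left_distrib u'_def)
      also have "\<dots> = b + (\<Sum>x\<in>B. s (u x) x)"
        using b finB by (simp add: sum.distrib)
      finally show ?thesis by simp
    qed
    then have 1: "b - (\<Sum>x\<in>B. s ((if x = b then 1 else 0) + u' x) x) \<in> W"
      using subspace_neg[OF W mem] by simp
    have "(\<Sum>x\<in>B. s (if x = b then 1 else 0) x) = (\<Sum>x\<in>B. (if x = b then x else 0))"
      by (rule sum.cong) auto
    then have 2: "b - (\<Sum>x\<in>B. s (if x = b then 1 else 0) x) \<in> W"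
      using b finB subspace_0[OF W] by simp
    have "\<exists>!c. (\<forall>x. x \<notin> B \<longrightarrow> c x = 0) \<and> b - (\<Sum>x\<in>B. s (c x) x) \<in> W"
      using B b BV unfolding basis_modulo_def by blast
    from ex1_eqD[OF this] have "(\<lambda>x. (if x = b then 1 else 0) + u' x) = (\<lambda>x. if x = b then 1 else 0)"
      using 1 2 b by (simp add: u'_def)
    from fun_cong[OF this, of b] show ?thesis using b by (simp add: u'_def)
  qed
  have inj: "inj_on p B"
  proof (rule inj_onI, rule ccontr)
    fix a b assume ab: "a \<in> B" "b \<in> B" "p a = p b" "a \<noteq> b"
    let ?u = "\<lambda>x. if x = a then 1 else if x = b then - 1 else (0::'a)"
    have "(\<Sum>x\<in>B. s (?u x) (p x)) = (\<Sum>x\<in>B. (if x = a then p x else 0) - (if x = b then p x else 0))"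
      using ab by (intro sum.cong) auto
    also have "\<dots> = 0" using ab finB by (simp add: sum_subtractf)
    finally show False using indep[of ?u a] ab by simp
  qed
  have "independent (p ` B)"
  proof (rule independent_if_scalars_zero)
    show "finite (p ` B)" using finB by simp
    fix f y assume "(\<Sum>y\<in>p ` B. s (f y) y) = 0" "y \<in> p ` B"
    then show "f y = 0" using indep[of "\<lambda>x. f (p x)"] by (auto simp: sum.reindex[OF inj])
  qed
  moreover have "p v \<in> span B'" for v
    unfolding p_def by (intro span_sum span_scale span_base)
  ultimately have "card (p ` B) \<le> card B'"
    using independent_span_bound[OF finB', of "p ` B"] by blast
  then show ?thesis by (simp add: card_image[OF inj])
qed

lemma quotient_dim_eq:
  assumes "vector_space s" and "module.subspace s W" and "basis_modulo s V W B"
  shows "quotient_dim s V W = enat (card B)"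
proof -
  have "(THE d. \<exists>B. basis_modulo s V W B \<and> card B = d) = card B"
  proof (rule the_equality)
    show "\<exists>B'. basis_modulo s V W B' \<and> card B' = card B" using assms(3) by blast
    fix d assume "\<exists>B'. basis_modulo s V W B' \<and> card B' = d"
    then show "d = card B" using basis_modulo_card_le[OF assms(1,2)] assms(3) by (metis le_antisym)
  qed
  then show ?thesis unfolding quotient_dim_def using assms(3) by auto
qed


section \<open>The Koszul complex of a graded module\<close>

text \<open>The sign \<open>(-1)\<^sup>k\<close> in an arbitrary abelian group.\<close>

definition signed :: "nat \<Rightarrow> 'm::ab_group_add \<Rightarrow> 'm" where
  "signed k y = (if even k then y else - y)"

text \<open>Chains are total functions on sets of indices, with the value 0 outside the sets of the
  right size, so that they form an abelian group pointwise. The piece \<open>N d\<close> of a graded module is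
  a subset of one ambient group, and only the pieces matter.\<close>

definition koszul_chains ::
  "nat \<Rightarrow> (nat \<Rightarrow> 'g::ab_group_add) \<Rightarrow> ('g \<Rightarrow> 'm::zero set) \<Rightarrow> 'g \<Rightarrow> nat \<Rightarrow> (nat set \<Rightarrow> 'm) set" where
  "koszul_chains n C N d j =
     {a. \<forall>S. if S \<subseteq> {..<n} \<and> card S = j then a S \<in> N (d - sum C S) else a S = 0}"

text \<open>The differential, described by its value at \<open>T\<close> instead of by the image of a single term: the
  sum runs over the sets \<open>insert i T\<close> from which \<open>i\<close> can be omitted to reach \<open>T\<close>. The sign counts the
  elements before \<open>i\<close>, one less than its position counted from 1.\<close>

definition koszul_diff ::
  "nat \<Rightarrow> (nat \<Rightarrow> 'm \<Rightarrow> 'm::ab_group_add) \<Rightarrow> (nat set \<Rightarrow> 'm) \<Rightarrow> nat set \<Rightarrow> 'm" where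
  "koszul_diff n X a T = (\<Sum>i\<in>{..<n} - T. signed (card {l\<in>T. l < i}) (X i (a (insert i T))))"

definition koszul_cycles where
  "koszul_cycles n C X N d j = {a \<in> koszul_chains n C N d j. koszul_diff n X a = 0}"

definition koszul_boundaries where
  "koszul_boundaries n C X N d j = koszul_diff n X ` koszul_chains n C N d (Suc j)"

definition pointwise_scale :: "('k \<Rightarrow> 'm \<Rightarrow> 'm) \<Rightarrow> 'k \<Rightarrow> ('s \<Rightarrow> 'm) \<Rightarrow> 's \<Rightarrow> 'm" where
  "pointwise_scale s c a = (\<lambda>S. s c (a S))"

lemma signed_0 [simp]: "signed k 0 = 0" by (simp add: signed_def)
lemma signed_diff: "signed k (x - y) = signed k x - signed k y" by (simp add: signed_def)
lemma signed_sum: "signed k (sum f A) = (\<Sum>i\<in>A. signed k (f i))"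
  by (simp add: signed_def sum_negf)
lemma signed_signed: "signed k (signed l y) = signed (k + l) y" by (simp add: signed_def)
lemma signed_Suc: "signed (Suc k) y = - signed k y" by (simp add: signed_def)

lemma card_below_insert:
  fixes i j :: nat
  assumes "j \<notin> T"
  shows "card {l \<in> insert j T. l < i} = card {l\<in>T. l < i} + (if j < i then 1 else 0)"
proof -
  have "{l \<in> insert j T. l < i} = (if j < i then insert j {l\<in>T. l < i} else {l\<in>T. l < i})" by auto
  then show ?thesis using assms by simp
qed

text \<open>A module over the polynomial ring graded by \<open>\<Gamma>\<close>, given by its pieces and the action of the variables.
  The set \<open>\<Gamma>\<close> of admissible degrees only has to be stable under subtracting the degrees of the variables,
  as these are the degrees that occur in a Koszul complex.\<close>

locale graded_module = vector_space s for s :: "'k::field \<Rightarrow> 'm::ab_group_add \<Rightarrow> 'm" +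
  fixes \<Gamma> :: "'g::ab_group_add set" and n :: nat and C :: "nat \<Rightarrow> 'g"
    and X :: "nat \<Rightarrow> 'm \<Rightarrow> 'm" and N :: "'g \<Rightarrow> 'm set"
  assumes degree_diff: "d \<in> \<Gamma> \<Longrightarrow> i < n \<Longrightarrow> d - C i \<in> \<Gamma>"
    and subspace_piece: "d \<in> \<Gamma> \<Longrightarrow> subspace (N d)"
    and linear_X: "Vector_Spaces.linear s s (X i)"
    and X_commute: "X i (X j v) = X j (X i v)"
    and X_mem: "d \<in> \<Gamma> \<Longrightarrow> i < n \<Longrightarrow> v \<in> N (d - C i) \<Longrightarrow> X i v \<in> N d"
begin

lemma X_0: "X i 0 = 0" and X_diff: "X i (v - w) = X i v - X i w"
  and X_add: "X i (v + w) = X i v + X i w"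
  and X_minus: "X i (- v) = - X i v" and X_scale: "X i (s c v) = s c (X i v)"
  and X_sum: "X i (sum f A) = (\<Sum>x\<in>A. X i (f x))"
proof -
  interpret Vector_Spaces.linear s s "X i" by (rule linear_X)
  show "X i 0 = 0" "X i (v - w) = X i v - X i w" "X i (v + w) = X i v + X i w"
    "X i (- v) = - X i v" "X i (s c v) = s c (X i v)" "X i (sum f A) = (\<Sum>x\<in>A. X i (f x))"
    by (rule zero diff add neg scale sum)+
qed

lemma X_signed: "X i (signed k v) = signed k (X i v)"
  by (simp add: signed_def X_minus)

lemma scale_signed: "s c (signed k v) = signed k (s c v)"
  by (simp add: signed_def)

lemma signed_mem: "d \<in> \<Gamma> \<Longrightarrow> v \<in> N d \<Longrightarrow> signed k v \<in> N d"
  by (simp add: signed_def subspace_neg subspace_piece)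

lemma degree_diff_sum: "d \<in> \<Gamma> \<Longrightarrow> S \<subseteq> {..<n} \<Longrightarrow> d - sum C S \<in> \<Gamma>"
proof -
  assume d: "d \<in> \<Gamma>" and S: "S \<subseteq> {..<n}"
  then have "finite S" using finite_subset by blast
  then show ?thesis using S
  proof (induction S)
    case (insert i S)
    then have "(d - sum C S) - C i \<in> \<Gamma>" by (intro degree_diff) auto
    then show ?case using insert by (simp add: algebra_simps)
  qed (simp add: d)
qed

lemma chains_diff:
  "d \<in> \<Gamma> \<Longrightarrow> a \<in> koszul_chains n C N d j \<Longrightarrow> b \<in> koszul_chains n C N d j
    \<Longrightarrow> a - b \<in> koszul_chains n C N d j"
  by (auto simp: koszul_chains_def intro!: subspace_diff[OF subspace_piece[OF degree_diff_sum]]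
      split: if_splits)

lemma chains_scale:
  "d \<in> \<Gamma> \<Longrightarrow> a \<in> koszul_chains n C N d j \<Longrightarrow> pointwise_scale s c a \<in> koszul_chains n C N d j"
  by (auto simp: koszul_chains_def pointwise_scale_def
      intro!: subspace_scale[OF subspace_piece[OF degree_diff_sum]] split: if_splits)

lemma koszul_diff_diff: "koszul_diff n X (a - b) = koszul_diff n X a - koszul_diff n X b"
  by (simp add: fun_eq_iff koszul_diff_def X_diff signed_diff sum_subtractf)

lemma koszul_diff_scale:
  "koszul_diff n X (pointwise_scale s c a) = pointwise_scale s c (koszul_diff n X a)"
  by (simp add: fun_eq_iff koszul_diff_def pointwise_scale_def X_scale scale_signed scale_sum_right)

lemma pointwise_scale_0: "pointwise_scale s c 0 = 0"
  by (simp add: fun_eq_iff pointwise_scale_def)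

lemma koszul_diff_mem:
  assumes d: "d \<in> \<Gamma>" and a: "a \<in> koszul_chains n C N d (Suc j)"
  shows "koszul_diff n X a \<in> koszul_chains n C N d j"
  unfolding koszul_chains_def
proof (intro CollectI allI)
  fix T
  have mem: "S \<subseteq> {..<n} \<Longrightarrow> card S = Suc j \<Longrightarrow> a S \<in> N (d - sum C S)"
    and zero: "\<not> (S \<subseteq> {..<n} \<and> card S = Suc j) \<Longrightarrow> a S = 0" for S
    using a unfolding koszul_chains_def by (auto split: if_splits)
  show "if T \<subseteq> {..<n} \<and> card T = j then koszul_diff n X a T \<in> N (d - sum C T)
    else koszul_diff n X a T = 0"
  proof (cases "T \<subseteq> {..<n} \<and> card T = j")
    case True
    then have fin: "finite T" and dT: "d - sum C T \<in> \<Gamma>"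
      using finite_subset degree_diff_sum[OF d] by auto
    have "koszul_diff n X a T \<in> N (d - sum C T)"
      unfolding koszul_diff_def
    proof (intro subspace_sum[OF subspace_piece[OF dT]] signed_mem[OF dT] X_mem[OF dT])
      fix i assume i: "i \<in> {..<n} - T"
      then show "a (insert i T) \<in> N (d - sum C T - C i)"
        using mem[of "insert i T"] True fin by (simp add: algebra_simps)
    qed simp
    then show ?thesis using True by simp
  next
    case False
    have "a (insert i T) = 0" if "i \<in> {..<n} - T" for i
    proof (rule zero, rule notI)
      assume *: "insert i T \<subseteq> {..<n} \<and> card (insert i T) = Suc j"
      then have "finite T" by (meson finite_insert finite_lessThan finite_subset)
      then show False using * that False by simp
    qed
    then have "koszul_diff n X a T = 0" unfolding koszul_diff_def by (simp add: X_0)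
    then show ?thesis by (simp only: False if_False)
  qed
qed

lemma koszul_diff_chains_0: "a \<in> koszul_chains n C N d 0 \<Longrightarrow> koszul_diff n X a = 0"
proof (rule ext)
  fix T assume a: "a \<in> koszul_chains n C N d 0"
  have "a (insert i T) = 0" for i
  proof -
    have "\<not> (insert i T \<subseteq> {..<n} \<and> card (insert i T) = 0)"
      by (metis card_0_eq finite_lessThan finite_subset insert_not_empty)
    then show ?thesis using a unfolding koszul_chains_def by (auto split: if_splits)
  qed
  then show "koszul_diff n X a T = 0 T" by (simp add: koszul_diff_def X_0)
qed

text \<open>Removing \<open>i < j\<close> in either order gives the same term with opposite signs. The terms are cancelled in
  pairs, which is valid in characteristic 2 as well.\<close>

lemma koszul_diff_koszul_diff: "koszul_diff n X (koszul_diff n X a) = 0"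
proof (rule ext)
  fix T :: "nat set"
  define g where "g i j = signed (card {l\<in>T. l < i} + card {l \<in> insert i T. l < j})
      (X i (X j (a (insert j (insert i T)))))" for i j
  let ?I = "{..<n} - T"
  have anti: "g i j + g j i = 0" if "i \<notin> T" "j \<notin> T" "i < j" for i j
  proof -
    have "card {l \<in> insert i T. l < j} = Suc (card {l\<in>T. l < j})"
      and "card {l \<in> insert j T. l < i} = card {l\<in>T. l < i}"
      using that card_below_insert[of i T j] card_below_insert[of j T i] by simp_all
    then show ?thesis
      unfolding g_def by (simp add: signed_Suc add.commute X_commute[of i j] insert_commute)
  qed
  have "koszul_diff n X (koszul_diff n X a) T = (\<Sum>i\<in>?I. \<Sum>j\<in>{..<n} - insert i T. g i j)"
    unfolding koszul_diff_def g_def by (simp add: X_sum X_signed signed_sum signed_signed)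
  also have "\<dots> = (\<Sum>(i, j)\<in>(SIGMA i:?I. {..<n} - insert i T). g i j)"
    by (rule sum.Sigma) auto
  also have "(SIGMA i:?I. {..<n} - insert i T)
      = {(i, j). i \<in> ?I \<and> j \<in> ?I \<and> i < j} \<union> {(i, j). i \<in> ?I \<and> j \<in> ?I \<and> j < i}" (is "_ = ?A \<union> ?B")
    by auto
  also have "(\<Sum>(i, j)\<in>?A \<union> ?B. g i j) = (\<Sum>(i, j)\<in>?A. g i j) + (\<Sum>(i, j)\<in>?B. g i j)"
  proof (rule sum.union_disjoint)
    show "finite ?A" "finite ?B"
      by (rule finite_subset[of _ "{..<n} \<times> {..<n}"]; auto)+
  qed auto
  also have "(\<Sum>(i, j)\<in>?B. g i j) = (\<Sum>(i, j)\<in>?A. g j i)"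
    by (rule sum.reindex_bij_witness[of _ prod.swap prod.swap]) auto
  also have "(\<Sum>(i, j)\<in>?A. g i j) + (\<Sum>(i, j)\<in>?A. g j i) = 0"
    unfolding sum.distrib[symmetric] using anti by (intro sum.neutral) auto
  finally show "koszul_diff n X (koszul_diff n X a) T = 0 T" by simp
qed

end


section \<open>Dimension shifting\<close>

text \<open>A map of graded modules onto its target. The map may depend on the degree, so that it can be
  the restriction of a global map followed by the extraction of a homogeneous component.\<close>

locale graded_surjection =
  source: graded_module s \<Gamma> n C X F + target: graded_module t \<Gamma> n C Y N
  for s :: "'k::field \<Rightarrow> 'f::ab_group_add \<Rightarrow> 'f" and t :: "'k \<Rightarrow> 'm::ab_group_add \<Rightarrow> 'm"
    and \<Gamma> :: "'g::ab_group_add set" and n C X F Y N +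
  fixes \<phi> :: "'g \<Rightarrow> 'f \<Rightarrow> 'm"
  assumes \<phi>_diff: "d \<in> \<Gamma> \<Longrightarrow> f \<in> F d \<Longrightarrow> g \<in> F d \<Longrightarrow> \<phi> d (f - g) = \<phi> d f - \<phi> d g"
    and \<phi>_scale: "d \<in> \<Gamma> \<Longrightarrow> f \<in> F d \<Longrightarrow> \<phi> d (s c f) = t c (\<phi> d f)"
    and \<phi>_image: "d \<in> \<Gamma> \<Longrightarrow> \<phi> d ` F d = N d"
    and \<phi>_X: "d \<in> \<Gamma> \<Longrightarrow> i < n \<Longrightarrow> f \<in> F (d - C i) \<Longrightarrow> \<phi> d (X i f) = Y i (\<phi> (d - C i) f)"
begin

definition kernel :: "'g \<Rightarrow> 'f set" where "kernel d = {f \<in> F d. \<phi> d f = 0}"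

lemma F_0: "d \<in> \<Gamma> \<Longrightarrow> 0 \<in> F d"
  and F_diff: "d \<in> \<Gamma> \<Longrightarrow> f \<in> F d \<Longrightarrow> g \<in> F d \<Longrightarrow> f - g \<in> F d"
  and F_scale: "d \<in> \<Gamma> \<Longrightarrow> f \<in> F d \<Longrightarrow> s c f \<in> F d"
  and F_sum: "d \<in> \<Gamma> \<Longrightarrow> (\<And>i. i \<in> A \<Longrightarrow> h i \<in> F d) \<Longrightarrow> sum h A \<in> F d"
  using source.subspace_piece[of d] source.subspace_0 source.subspace_diff source.subspace_scale
    source.subspace_sum by blast+

lemma \<phi>_0: "d \<in> \<Gamma> \<Longrightarrow> \<phi> d 0 = 0"
  using \<phi>_diff[of d 0 0] F_0 by simp

lemma \<phi>_minus: "d \<in> \<Gamma> \<Longrightarrow> f \<in> F d \<Longrightarrow> \<phi> d (- f) = - \<phi> d f"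
  using \<phi>_diff[of d 0 f] F_0 \<phi>_0 by simp

lemma \<phi>_add: "d \<in> \<Gamma> \<Longrightarrow> f \<in> F d \<Longrightarrow> g \<in> F d \<Longrightarrow> \<phi> d (f + g) = \<phi> d f + \<phi> d g"
  using \<phi>_diff[of d f "- g"] F_diff[of d 0 g] F_0 \<phi>_minus by simp

lemma \<phi>_signed: "d \<in> \<Gamma> \<Longrightarrow> f \<in> F d \<Longrightarrow> \<phi> d (signed k f) = signed k (\<phi> d f)"
  by (simp add: signed_def \<phi>_minus)

lemma \<phi>_sum:
  "d \<in> \<Gamma> \<Longrightarrow> (\<And>i. i \<in> A \<Longrightarrow> h i \<in> F d) \<Longrightarrow> \<phi> d (sum h A) = (\<Sum>i\<in>A. \<phi> d (h i))"
  by (induction A rule: infinite_finite_induct) (simp_all add: \<phi>_0 \<phi>_add F_sum)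

lemma graded_module_kernel: "graded_module s \<Gamma> n C X kernel"
proof
  show "source.subspace (kernel d)" if "d \<in> \<Gamma>" for d
  proof (rule source.subspaceI)
    fix f g c assume "f \<in> kernel d" "g \<in> kernel d"
    then show "f + g \<in> kernel d"
      using that source.subspace_add[OF source.subspace_piece[OF that]]
      by (simp add: kernel_def \<phi>_add)
  qed (use that in \<open>auto simp: kernel_def \<phi>_0 F_0 F_scale \<phi>_scale\<close>)
  show "X i v \<in> kernel d" if "d \<in> \<Gamma>" "i < n" "v \<in> kernel (d - C i)" for d i v
    using that by (simp add: kernel_def source.X_mem \<phi>_X target.X_0)
qed (fact source.degree_diff source.X_add source.X_scale source.X_commute)+

definition chain_map :: "'g \<Rightarrow> (nat set \<Rightarrow> 'f) \<Rightarrow> nat set \<Rightarrow> 'm" where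
  "chain_map d a = (\<lambda>S. if S \<subseteq> {..<n} then \<phi> (d - sum C S) (a S) else 0)"

context
  fixes d assumes d: "d \<in> \<Gamma>"
begin

lemma degree_mem: "S \<subseteq> {..<n} \<Longrightarrow> d - sum C S \<in> \<Gamma>"
  by (rule source.degree_diff_sum[OF d])

lemma chain_value_mem: "a \<in> koszul_chains n C F d j \<Longrightarrow> S \<subseteq> {..<n} \<Longrightarrow> a S \<in> F (d - sum C S)"
  unfolding koszul_chains_def using F_0[OF degree_mem] by (auto split: if_splits)

lemma chain_map_mem:
  "a \<in> koszul_chains n C F d j \<Longrightarrow> chain_map d a \<in> koszul_chains n C N d j"
  unfolding koszul_chains_def chain_map_def
  using \<phi>_0[OF degree_mem] \<phi>_image[OF degree_mem, THEN equalityD1, THEN subsetD, OF _ imageI]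
  by (auto split: if_splits)

lemma chain_map_diff:
  "a \<in> koszul_chains n C F d j \<Longrightarrow> b \<in> koszul_chains n C F d j
    \<Longrightarrow> chain_map d (a - b) = chain_map d a - chain_map d b"
  by (auto simp: fun_eq_iff chain_map_def \<phi>_diff[OF degree_mem] chain_value_mem)

lemma chain_map_scale:
  "a \<in> koszul_chains n C F d j
    \<Longrightarrow> chain_map d (pointwise_scale s c a) = pointwise_scale t c (chain_map d a)"
  by (auto simp: fun_eq_iff chain_map_def pointwise_scale_def \<phi>_scale[OF degree_mem] chain_value_mem)

lemma chain_map_koszul_diff:
  assumes a: "a \<in> koszul_chains n C F d j"
  shows "chain_map d (koszul_diff n X a) = koszul_diff n Y (chain_map d a)"
proof (rule ext)
  fix T
  show "chain_map d (koszul_diff n X a) T = koszul_diff n Y (chain_map d a) T"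
  proof (cases "T \<subseteq> {..<n}")
    case True
    then have fin: "finite T" and dT: "d - sum C T \<in> \<Gamma>"
      using finite_subset degree_mem by auto
    have val: "a (insert i T) \<in> F (d - sum C T - C i)" if "i \<in> {..<n} - T" for i
      using chain_value_mem[OF a, of "insert i T"] that True fin by (simp add: algebra_simps)
    have "chain_map d (koszul_diff n X a) T = (\<Sum>i\<in>{..<n} - T.
        \<phi> (d - sum C T) (signed (card {l\<in>T. l < i}) (X i (a (insert i T)))))"
      unfolding chain_map_def koszul_diff_def if_P[OF True]
      using val by (intro \<phi>_sum[OF dT] source.signed_mem[OF dT] source.X_mem[OF dT]) auto
    also have "\<dots> = koszul_diff n Y (chain_map d a) T"
      unfolding koszul_diff_def
    proof (rule sum.cong[OF refl])
      fix i assume i: "i \<in> {..<n} - T"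
      have eq: "d - sum C (insert i T) = d - sum C T - C i"
        using i fin by (simp add: algebra_simps)
      have "chain_map d a (insert i T) = \<phi> (d - sum C T - C i) (a (insert i T))"
        unfolding chain_map_def eq using i True by simp
      then show "\<phi> (d - sum C T) (signed (card {l\<in>T. l < i}) (X i (a (insert i T))))
          = signed (card {l\<in>T. l < i}) (Y i (chain_map d a (insert i T)))"
        using i True val[OF i]
        by (simp add: \<phi>_signed[OF dT] source.X_mem[OF dT] \<phi>_X[OF dT])
    qed
    finally show ?thesis .
  next
    case False
    then show ?thesis by (auto simp: chain_map_def koszul_diff_def target.X_0)
  qed
qed

lemma chain_map_surj:
  assumes w: "w \<in> koszul_chains n C N d j"
  obtains g where "g \<in> koszul_chains n C F d j" "chain_map d g = w"
proof -
  have "\<exists>f. if S \<subseteq> {..<n} \<and> card S = j then f \<in> F (d - sum C S) \<and> \<phi> (d - sum C S) f = w S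
      else f = 0" for S
  proof (cases "S \<subseteq> {..<n} \<and> card S = j")
    case True
    then have "w S \<in> N (d - sum C S)" using w unfolding koszul_chains_def by (auto split: if_splits)
    moreover have "N (d - sum C S) = \<phi> (d - sum C S) ` F (d - sum C S)"
      using \<phi>_image[OF degree_mem[of S]] True by simp
    ultimately show ?thesis using True by auto
  qed auto
  then obtain g where g: "\<And>S. if S \<subseteq> {..<n} \<and> card S = j
      then g S \<in> F (d - sum C S) \<and> \<phi> (d - sum C S) (g S) = w S else g S = 0" by metis
  have "w S = 0" if "\<not> (S \<subseteq> {..<n} \<and> card S = j)" for S
    using w that unfolding koszul_chains_def by (metis (mono_tags, lifting) mem_Collect_eq)
  then have "chain_map d g = w"
    using g \<phi>_0[OF degree_mem] unfolding chain_map_def fun_eq_iff by (metis (mono_tags, lifting))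
  moreover have "g \<in> koszul_chains n C F d j"
    using g unfolding koszul_chains_def by (auto split: if_splits)
  ultimately show ?thesis using that by blast
qed

lemma chains_kernel_iff:
  "a \<in> koszul_chains n C kernel d j \<longleftrightarrow> a \<in> koszul_chains n C F d j \<and> chain_map d a = 0"
proof
  assume a: "a \<in> koszul_chains n C kernel d j"
  have "chain_map d a S = 0" for S
    using a \<phi>_0[OF degree_mem, of S] unfolding koszul_chains_def chain_map_def kernel_def
    by (cases "S \<subseteq> {..<n} \<and> card S = j") (auto dest!: spec[of _ S])
  then show "a \<in> koszul_chains n C F d j \<and> chain_map d a = 0"
    using a unfolding koszul_chains_def kernel_def fun_eq_iff by (auto split: if_splits)
next
  assume "a \<in> koszul_chains n C F d j \<and> chain_map d a = 0"
  then show "a \<in> koszul_chains n C kernel d j"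
    unfolding koszul_chains_def kernel_def chain_map_def fun_eq_iff by (auto split: if_splits)
qed

text \<open>The connecting homomorphism of \<open>0 \<rightarrow> kernel \<rightarrow> F \<rightarrow> N \<rightarrow> 0\<close>, as the relation between a cycle \<open>z\<close> and the boundary
  of a lift of \<open>z\<close>. Acyclicity of \<open>F\<close> in degree \<open>j + 1\<close> makes it injective; it is surjective as
  soon as the cycles of the kernel bound in \<open>F\<close>. For \<open>j > 0\<close> this is again acyclicity, while for \<open>j = 0\<close> it
  says that the kernel lies in \<open>(x\<^sub>1, \<dots>, x\<^sub>n) F\<close>, which is the minimality of a resolution.\<close>

theorem connecting_isomorphism:
  assumes acyclic: "\<And>a. a \<in> koszul_cycles n C X F d (Suc j) \<Longrightarrow> a \<in> koszul_boundaries n C X F d (Suc j)"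
    and minimal: "\<And>a. a \<in> koszul_cycles n C X kernel d j \<Longrightarrow> a \<in> koszul_boundaries n C X F d j"
  shows "isomorphic_quotients
    (pointwise_scale t) (koszul_cycles n C Y N d (Suc j)) (koszul_boundaries n C Y N d (Suc j))
    (pointwise_scale s) (koszul_cycles n C X kernel d j) (koszul_boundaries n C X kernel d j)"
proof -
  let ?D = "koszul_diff n X"
  define \<rho> where "\<rho> z z' \<longleftrightarrow> (\<exists>f\<in>koszul_chains n C F d (Suc j). chain_map d f = z \<and> ?D f = z'
      \<and> koszul_diff n Y z = 0)" for z z'
  have bd: "?D f \<in> koszul_cycles n C X kernel d j"
    if f: "f \<in> koszul_chains n C F d (Suc j)" and z: "koszul_diff n Y (chain_map d f) = 0" for f
    using source.koszul_diff_mem[OF d f] z source.koszul_diff_koszul_diff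
    by (simp add: koszul_cycles_def chains_kernel_iff chain_map_koszul_diff[OF f])
  have "linear_correspondence
    (pointwise_scale t) (koszul_cycles n C Y N d (Suc j)) (koszul_boundaries n C Y N d (Suc j))
    (pointwise_scale s) (koszul_cycles n C X kernel d j) (koszul_boundaries n C X kernel d j) \<rho>"
    unfolding linear_correspondence_def
  proof (intro conjI allI impI ballI)
    fix z z' assume "\<rho> z z'"
    then obtain f where f: "f \<in> koszul_chains n C F d (Suc j)" and z: "chain_map d f = z"
      and z': "?D f = z'" and cyc: "koszul_diff n Y z = 0" unfolding \<rho>_def by blast
    show "z \<in> koszul_cycles n C Y N d (Suc j)"
      using chain_map_mem[OF f] z cyc by (simp add: koszul_cycles_def)
    show "z' \<in> koszul_cycles n C X kernel d j" using bd[OF f] z z' cyc by simp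
    show "z \<in> koszul_boundaries n C Y N d (Suc j) \<longleftrightarrow> z' \<in> koszul_boundaries n C X kernel d j"
    proof
      assume "z \<in> koszul_boundaries n C Y N d (Suc j)"
      then obtain w where w: "w \<in> koszul_chains n C N d (Suc (Suc j))" "koszul_diff n Y w = z"
        unfolding koszul_boundaries_def by auto
      obtain g where g: "g \<in> koszul_chains n C F d (Suc (Suc j))" "chain_map d g = w"
        using chain_map_surj[OF w(1)] .
      have dg: "?D g \<in> koszul_chains n C F d (Suc j)" by (rule source.koszul_diff_mem[OF d g(1)])
      \<comment> \<open>Subtracting the boundary of a lift of \<open>w\<close> moves \<open>f\<close> into the kernel without changing its boundary.\<close>
      have "chain_map d (f - ?D g) = 0"
        using chain_map_diff[OF f dg] chain_map_koszul_diff[OF g(1)] g w z by simp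
      then have "f - ?D g \<in> koszul_chains n C kernel d (Suc j)"
        by (simp add: chains_kernel_iff source.chains_diff[OF d f dg])
      moreover have "?D (f - ?D g) = z'"
        using z' by (simp add: source.koszul_diff_diff source.koszul_diff_koszul_diff)
      ultimately show "z' \<in> koszul_boundaries n C X kernel d j"
        unfolding koszul_boundaries_def by blast
    next
      assume "z' \<in> koszul_boundaries n C X kernel d j"
      then obtain y where y: "y \<in> koszul_chains n C kernel d (Suc j)" "?D y = z'"
        unfolding koszul_boundaries_def by auto
      then have yF: "y \<in> koszul_chains n C F d (Suc j)" "chain_map d y = 0"
        by (simp_all add: chains_kernel_iff)
      \<comment> \<open>The lift of \<open>z\<close> can be corrected by \<open>y\<close> without changing its image, and then it is a cycle.\<close>
      have "f - y \<in> koszul_cycles n C X F d (Suc j)"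
        using source.chains_diff[OF d f yF(1)] y z'
        by (simp add: koszul_cycles_def source.koszul_diff_diff)
      from acyclic[OF this] obtain g where g: "g \<in> koszul_chains n C F d (Suc (Suc j))"
        "?D g = f - y" unfolding koszul_boundaries_def by auto
      have "koszul_diff n Y (chain_map d g) = z"
        using chain_map_koszul_diff[OF g(1)] g chain_map_diff[OF f yF(1)] yF z by simp
      then show "z \<in> koszul_boundaries n C Y N d (Suc j)"
        using chain_map_mem[OF g(1)] unfolding koszul_boundaries_def by blast
    qed
  next
    fix z z' w w' assume "\<rho> z z'" "\<rho> w w'"
    then obtain f g where "f \<in> koszul_chains n C F d (Suc j)" "chain_map d f = z" "?D f = z'"
      "koszul_diff n Y z = 0" "g \<in> koszul_chains n C F d (Suc j)" "chain_map d g = w" "?D g = w'"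
      "koszul_diff n Y w = 0" unfolding \<rho>_def by blast
    then show "\<rho> (z - w) (z' - w')"
      unfolding \<rho>_def using source.chains_diff[OF d] chain_map_diff
      by (intro bexI[of _ "f - g"]) (auto simp: source.koszul_diff_diff target.koszul_diff_diff)
  next
    fix c z z' assume "\<rho> z z'"
    then obtain f where "f \<in> koszul_chains n C F d (Suc j)" "chain_map d f = z" "?D f = z'"
      "koszul_diff n Y z = 0" unfolding \<rho>_def by blast
    then show "\<rho> (pointwise_scale t c z) (pointwise_scale s c z')"
      unfolding \<rho>_def using source.chains_scale[OF d] chain_map_scale
      by (intro bexI[of _ "pointwise_scale s c f"])
        (auto simp: source.koszul_diff_scale target.koszul_diff_scale target.pointwise_scale_0)
  next
    fix z assume "z \<in> koszul_cycles n C Y N d (Suc j)"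
    then have z: "z \<in> koszul_chains n C N d (Suc j)" "koszul_diff n Y z = 0"
      by (auto simp: koszul_cycles_def)
    then show "\<exists>z'. \<rho> z z'" using chain_map_surj[OF z(1)] unfolding \<rho>_def by metis
  next
    fix z' assume z': "z' \<in> koszul_cycles n C X kernel d j"
    from minimal[OF this] obtain f where f: "f \<in> koszul_chains n C F d (Suc j)" "?D f = z'"
      unfolding koszul_boundaries_def by auto
    have "koszul_diff n Y (chain_map d f) = 0"
      using z' f chain_map_koszul_diff[OF f(1)] by (simp add: koszul_cycles_def chains_kernel_iff)
    then show "\<exists>z. \<rho> z z'" using f unfolding \<rho>_def by blast
  qed
  then show ?thesis unfolding isomorphic_quotients_def by blast
qed

text \<open>If the kernel lies in \<open>(x\<^sub>1, \<dots>, x\<^sub>n) F\<close>, then \<open>F\<close> and its quotient \<open>N\<close> have the same minimal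
  generators.\<close>

theorem augmentation_isomorphism:
  assumes minimal: "\<And>a. a \<in> koszul_cycles n C X kernel d 0 \<Longrightarrow> a \<in> koszul_boundaries n C X F d 0"
  shows "isomorphic_quotients
    (pointwise_scale t) (koszul_cycles n C Y N d 0) (koszul_boundaries n C Y N d 0)
    (pointwise_scale s) (koszul_cycles n C X F d 0) (koszul_boundaries n C X F d 0)"
proof -
  let ?D = "koszul_diff n X"
  have cyc: "koszul_cycles n C X F d 0 = koszul_chains n C F d 0"
    "koszul_cycles n C Y N d 0 = koszul_chains n C N d 0"
    using source.koszul_diff_chains_0 target.koszul_diff_chains_0 by (auto simp: koszul_cycles_def)
  have "linear_correspondence
    (pointwise_scale t) (koszul_cycles n C Y N d 0) (koszul_boundaries n C Y N d 0)
    (pointwise_scale s) (koszul_cycles n C X F d 0) (koszul_boundaries n C X F d 0)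
    (\<lambda>z f. f \<in> koszul_chains n C F d 0 \<and> chain_map d f = z)"
    unfolding linear_correspondence_def cyc
  proof (intro conjI allI impI ballI; (elim conjE)?)
    fix z f assume f: "f \<in> koszul_chains n C F d 0" and z: "chain_map d f = z"
    show "z \<in> koszul_chains n C N d 0" using chain_map_mem[OF f] z by simp
    show "f \<in> koszul_chains n C F d 0" by (rule f)
    show "z \<in> koszul_boundaries n C Y N d 0 \<longleftrightarrow> f \<in> koszul_boundaries n C X F d 0"
    proof
      assume "f \<in> koszul_boundaries n C X F d 0"
      then obtain g where g: "g \<in> koszul_chains n C F d (Suc 0)" "?D g = f"
        unfolding koszul_boundaries_def by auto
      then have "koszul_diff n Y (chain_map d g) = z"
        using chain_map_koszul_diff[OF g(1)] z by simp
      then show "z \<in> koszul_boundaries n C Y N d 0"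
        using chain_map_mem[OF g(1)] unfolding koszul_boundaries_def by blast
    next
      assume "z \<in> koszul_boundaries n C Y N d 0"
      then obtain w where w: "w \<in> koszul_chains n C N d (Suc 0)" "koszul_diff n Y w = z"
        unfolding koszul_boundaries_def by auto
      obtain g where g: "g \<in> koszul_chains n C F d (Suc 0)" "chain_map d g = w"
        using chain_map_surj[OF w(1)] .
      have dg: "?D g \<in> koszul_chains n C F d 0" by (rule source.koszul_diff_mem[OF d g(1)])
      have "chain_map d (f - ?D g) = 0"
        using chain_map_diff[OF f dg] chain_map_koszul_diff[OF g(1)] g w z by simp
      then have "f - ?D g \<in> koszul_cycles n C X kernel d 0"
        using source.chains_diff[OF d f dg]
        by (simp add: koszul_cycles_def chains_kernel_iff source.koszul_diff_chains_0)
      from minimal[OF this] obtain h where h: "h \<in> koszul_chains n C F d (Suc 0)"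
        "?D h = f - ?D g" unfolding koszul_boundaries_def by auto
      \<comment> \<open>This is \<open>h + g\<close>.\<close>
      have "h - (0 - g) \<in> koszul_chains n C F d (Suc 0)"
        using g h source.chains_diff[OF d] by (metis diff_self)
      moreover have "?D (h - (0 - g)) = f"
        using h source.koszul_diff_diff[of g g] by (simp only: source.koszul_diff_diff diff_self) simp
      ultimately show "f \<in> koszul_boundaries n C X F d 0"
        unfolding koszul_boundaries_def by blast
    qed
  next
    fix z assume "z \<in> koszul_chains n C N d 0"
    then show "\<exists>f. f \<in> koszul_chains n C F d 0 \<and> chain_map d f = z"
      using chain_map_surj by metis
  qed (auto simp: chain_map_diff chain_map_scale source.chains_diff[OF d] source.chains_scale[OF d])
  then show ?thesis unfolding isomorphic_quotients_def by blast
qed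

end

end


section \<open>A contracting homotopy for polynomials\<close>

text \<open>For the polynomial ring, \<open>L v\<close> is the operator that divides by \<open>x\<^sub>v\<close> those monomials in which \<open>v\<close> is the
  least variable and kills all others. Then \<open>X i \<circ> L i\<close> is the projection to the monomials with
  least variable \<open>i\<close>, and \<open>L v \<circ> X v\<close> the projection to the monomials without variables below \<open>v\<close>; this is where
  the assumption on \<open>L v (X v y)\<close> comes from.\<close>

locale contractible_module = graded_module +
  fixes L :: "nat \<Rightarrow> 'b \<Rightarrow> 'b"
  assumes L_add: "L v (x + y) = L v x + L v y"
    and L_X_greater: "v < w \<Longrightarrow> L v (X w y) = X w (L v y)"
    and L_X_less: "w < v \<Longrightarrow> L v (X w y) = 0"
    and L_X_same: "L v (X v y) + (\<Sum>i<v. X i (L i y)) = y"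
    and L_mem: "d \<in> \<Gamma> \<Longrightarrow> v < n \<Longrightarrow> y \<in> N d \<Longrightarrow> L v y \<in> N (d - C v)"
begin

lemma L_0: "L v 0 = 0" using L_add[of v 0 0] by simp
lemma L_minus: "L v (- y) = - L v y" using L_add[of v y "- y"] L_0 by (simp add: eq_neg_iff_add_eq_0 add.commute)
lemma L_signed: "L v (signed k y) = signed k (L v y)" by (simp add: signed_def L_minus)
lemma L_sum: "L v (sum f A) = (\<Sum>i\<in>A. L v (f i))"
  by (induction A rule: infinite_finite_induct) (simp_all add: L_0 L_add)

text \<open>A monomial times \<open>u\<^sub>S\<close> is sent to its quotient by \<open>x\<^sub>v\<close> times the basis element of \<open>insert v S\<close>, where
  \<open>v\<close> is the least index occurring in the monomial or in \<open>S\<close>, and to 0 if \<open>v \<in> S\<close>.\<close>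

definition homotopy :: "(nat set \<Rightarrow> 'b) \<Rightarrow> nat set \<Rightarrow> 'b" where
  "homotopy a T = (if T \<subseteq> {..<n} \<and> T \<noteq> {} then L (Min T) (a (T - {Min T})) else 0)"

lemma homotopy_mem:
  assumes d: "d \<in> \<Gamma>" and a: "a \<in> koszul_chains n C N d j"
  shows "homotopy a \<in> koszul_chains n C N d (Suc j)"
  unfolding koszul_chains_def
proof (intro CollectI allI)
  fix T
  show "if T \<subseteq> {..<n} \<and> card T = Suc j then homotopy a T \<in> N (d - sum C T) else homotopy a T = 0"
  proof (cases "T \<subseteq> {..<n} \<and> T \<noteq> {}")
    case True
    then have fin: "finite T" using finite_subset by blast
    define v where "v = Min T"
    have v: "v \<in> T" using True fin by (simp add: v_def)
    then have "v < n" using True by auto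
    have h: "homotopy a T = L v (a (T - {v}))" using True by (simp add: homotopy_def v_def)
    have card: "card (T - {v}) = j \<longleftrightarrow> card T = Suc j" using card.remove[OF fin v] by auto
    have aT: "if T - {v} \<subseteq> {..<n} \<and> card (T - {v}) = j then a (T - {v}) \<in> N (d - sum C (T - {v}))
        else a (T - {v}) = 0"
      using a unfolding koszul_chains_def by blast
    show ?thesis
    proof (cases "card T = Suc j")
      case cT: True
      have "L v (a (T - {v})) \<in> N (d - sum C (T - {v}) - C v)"
        using aT True cT card \<open>v < n\<close> by (intro L_mem degree_diff_sum d) (auto split: if_splits)
      also have "d - sum C (T - {v}) - C v = d - sum C T"
        using sum.remove[OF fin v, of C] by (simp add: algebra_simps)
      finally show ?thesis using True cT h by simp
    next
      case False
      then show ?thesis using aT card h True by (simp add: L_0)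
    qed
  next
    case False
    then show ?thesis by (auto simp: homotopy_def)
  qed
qed

lemma koszul_diff_homotopy_empty:
  "koszul_diff n X (homotopy a) {} = (\<Sum>i<n. X i (L i (a {})))"
  by (simp add: koszul_diff_def signed_def homotopy_def)

text \<open>Let \<open>v = Min T\<close>. In the first summand the indices \<open>i < v\<close> contribute the parts of \<open>a T\<close> with least variable
  \<open>i\<close>. In the second summand they contribute nothing, and \<open>i = v\<close> contributes the part of \<open>a T\<close> without
  variables below \<open>v\<close>. The indices \<open>i > v\<close> cancel, since \<open>v\<close> adds one to the position of \<open>i\<close>.\<close>

lemma homotopy_identity:
  assumes T: "T \<subseteq> {..<n}" "T \<noteq> {}"
  shows "koszul_diff n X (homotopy a) T + homotopy (koszul_diff n X a) T = a T"
proof -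
  have fin: "finite T" using T finite_subset by blast
  define v where "v = Min T"
  have vT: "v \<in> T" and v_le: "\<And>l. l \<in> T \<Longrightarrow> v \<le> l" using T fin by (simp_all add: v_def)
  have "v < n" using vT T by auto
  define g where "g i = signed (card {l\<in>T. l < i}) (X i (L v (a (insert i T - {v}))))" for i
  let ?I = "{..<n} - T"
  have below: "{l\<in>T. l < i} = {}" if "i \<le> v" for i using v_le that by fastforce
  have I: "?I = {..<v} \<union> {i\<in>?I. v < i}" "{..<v} \<inter> {i\<in>?I. v < i} = {}"
    using \<open>v < n\<close> v_le vT by (auto simp: nat_neq_iff not_less dest: leD) (metis leD linorder_neqE_nat)
  have "koszul_diff n X (homotopy a) T
      = (\<Sum>i\<in>{..<v}. X i (L i (a T))) + (\<Sum>i\<in>{i\<in>?I. v < i}. g i)"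
  proof -
    have 1: "signed (card {l\<in>T. l < i}) (X i (homotopy a (insert i T))) = X i (L i (a T))" if "i < v" for i
    proof -
      have "Min (insert i T) = i" using that v_le fin T by (intro Min_eqI) (auto intro: less_imp_le dest: v_le)
      moreover have "i \<notin> T" using v_le that by fastforce
      ultimately show ?thesis
        unfolding below[OF less_imp_le[OF that]]
        using that \<open>v < n\<close> T by (simp add: homotopy_def signed_def)
    qed
    have 2: "signed (card {l\<in>T. l < i}) (X i (homotopy a (insert i T))) = g i" if "i \<in> {i\<in>?I. v < i}" for i
    proof -
      have "Min (insert i T) = v" using that v_le vT fin by (intro Min_eqI) auto
      then show ?thesis using that T by (simp add: homotopy_def g_def)
    qed
    have "koszul_diff n X (homotopy a) T
      = (\<Sum>i\<in>{..<v} \<union> {i\<in>?I. v < i}. signed (card {l\<in>T. l < i}) (X i (homotopy a (insert i T))))"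
      unfolding koszul_diff_def I(1)[symmetric] ..
    also have "\<dots> = (\<Sum>i\<in>{..<v}. signed (card {l\<in>T. l < i}) (X i (homotopy a (insert i T))))
        + (\<Sum>i\<in>{i\<in>?I. v < i}. signed (card {l\<in>T. l < i}) (X i (homotopy a (insert i T))))"
      by (rule sum.union_disjoint) (use I(2) in auto)
    finally show ?thesis using 1 2 by simp
  qed
  moreover have "homotopy (koszul_diff n X a) T = L v (X v (a T)) - (\<Sum>i\<in>{i\<in>?I. v < i}. g i)"
  proof -
    have J: "{..<n} - (T - {v}) = insert v ({..<v} \<union> {i\<in>?I. v < i})"
      using I(1) vT \<open>v < n\<close> by blast
    have ins: "insert v (T - {v}) = T" using vT by auto
    have 0: "L v (signed (card {l \<in> T - {v}. l < v}) (X v (a (insert v (T - {v}))))) = L v (X v (a T))"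
    proof -
      have empty: "{l \<in> T - {v}. l < v} = {}" using v_le by fastforce
      show ?thesis unfolding ins empty by (simp add: signed_def)
    qed
    have 1: "L v (signed k (X i b)) = 0" if "i \<in> {..<v}" for i k b
      using that by (simp add: L_signed L_X_less)
    have 2: "L v (signed (card {l \<in> T - {v}. l < i}) (X i (a (insert i (T - {v}))))) = - g i"
      if "i \<in> {i\<in>?I. v < i}" for i
    proof -
      have "card {l\<in>T. l < i} = Suc (card {l\<in>T - {v}. l < i})"
        using card_below_insert[of v "T - {v}" i] that unfolding ins by simp
      moreover have "insert i T - {v} = insert i (T - {v})" using that by auto
      ultimately show ?thesis
        using that unfolding g_def by (simp add: L_signed L_X_greater signed_Suc)
    qed
    have "homotopy (koszul_diff n X a) T = L v (koszul_diff n X a (T - {v}))"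
      using T by (simp add: homotopy_def v_def)
    also have "\<dots> = (\<Sum>i\<in>insert v ({..<v} \<union> {i\<in>?I. v < i}).
        L v (signed (card {l \<in> T - {v}. l < i}) (X i (a (insert i (T - {v}))))))"
      unfolding koszul_diff_def J L_sum ..
    also have "\<dots> = L v (X v (a T)) + (\<Sum>i\<in>{..<v} \<union> {i\<in>?I. v < i}.
        L v (signed (card {l \<in> T - {v}. l < i}) (X i (a (insert i (T - {v}))))))"
      by (subst sum.insert) (simp_all only: 0, auto)
    also have "\<dots> = L v (X v (a T)) + ((\<Sum>i\<in>{..<v}. 0) + (\<Sum>i\<in>{i\<in>?I. v < i}. - g i))"
      by (subst sum.union_disjoint) (use I(2) 1 2 in auto)
    finally show ?thesis by (simp add: sum_negf)
  qed
  ultimately have "koszul_diff n X (homotopy a) T + homotopy (koszul_diff n X a) T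
      = L v (X v (a T)) + (\<Sum>i<v. X i (L i (a T)))" by simp
  then show ?thesis by (simp only: L_X_same)
qed

lemma koszul_acyclic:
  assumes d: "d \<in> \<Gamma>" and a: "a \<in> koszul_cycles n C X N d (Suc j)"
  shows "a \<in> koszul_boundaries n C X N d (Suc j)"
proof -
  have ch: "a \<in> koszul_chains n C N d (Suc j)" and cyc: "koszul_diff n X a = 0"
    using a by (auto simp: koszul_cycles_def)
  have h: "homotopy a \<in> koszul_chains n C N d (Suc (Suc j))" by (rule homotopy_mem[OF d ch])
  have zero: "b T = 0" if "b \<in> koszul_chains n C N d (Suc j)" "\<not> (T \<subseteq> {..<n} \<and> T \<noteq> {})" for b T
    using that unfolding koszul_chains_def by (auto dest!: spec[of _ T] split: if_splits)
  have "koszul_diff n X (homotopy a) T = a T" for T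
  proof (cases "T \<subseteq> {..<n} \<and> T \<noteq> {}")
    case True
    then have "homotopy (0 :: nat set \<Rightarrow> 'b) T = 0" by (simp add: homotopy_def L_0)
    then show ?thesis using homotopy_identity[of T a] True cyc by simp
  next
    case False
    show ?thesis using zero[OF ch False] zero[OF koszul_diff_mem[OF d h] False] by simp
  qed
  then have "koszul_diff n X (homotopy a) = a" by (rule ext)
  then show ?thesis using h unfolding koszul_boundaries_def by (metis imageI)
qed

text \<open>At the empty set the homotopy only recovers the part of the value in \<open>(x\<^sub>1, \<dots>, x\<^sub>n)\<close>, hence the
  hypothesis on the value.\<close>

lemma koszul_boundaries_0:
  assumes d: "d \<in> \<Gamma>" and a: "a \<in> koszul_chains n C N d 0"
    and eq: "(\<Sum>i<n. X i (L i (a {}))) = a {}"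
  shows "a \<in> koszul_boundaries n C X N d 0"
proof -
  have h: "homotopy a \<in> koszul_chains n C N d (Suc 0)" by (rule homotopy_mem[OF d a])
  have zero: "b T = 0" if "b \<in> koszul_chains n C N d 0" "T \<noteq> {}" for b T
    using that finite_subset[of T "{..<n}"] unfolding koszul_chains_def
    by (auto dest!: spec[of _ T] split: if_splits)
  have "koszul_diff n X (homotopy a) T = a T" for T
    using zero[OF a, of T] zero[OF koszul_diff_mem[OF d h], of T] eq koszul_diff_homotopy_empty[of a]
    by (cases "T = {}") auto
  then have "koszul_diff n X (homotopy a) = a" by (rule ext)
  then show ?thesis using h unfolding koszul_boundaries_def by (metis imageI)
qed

end


section \<open>Graded free modules over the polynomial ring\<close>

definition mpoly_variable :: "nat \<Rightarrow> (nat, 'k::comm_ring_1) mpoly" where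
  "mpoly_variable i = Poly_Mapping.single (Poly_Mapping.single i 1) 1"

definition divide_least_variable :: "nat \<Rightarrow> (nat, 'k::zero) mpoly \<Rightarrow> (nat, 'k) mpoly" where
  "divide_least_variable v p = Poly_Mapping.mapp (\<lambda>m c. if \<forall>w\<in>keys m. v \<le> w then c else 0)
     (Poly_Mapping.map_key (\<lambda>m. m + Poly_Mapping.single v 1) p)"

definition free_scale :: "'k::comm_ring_1 \<Rightarrow> (nat \<Rightarrow>\<^sub>0 (nat, 'k) mpoly) \<Rightarrow> (nat \<Rightarrow>\<^sub>0 (nat, 'k) mpoly)" where
  "free_scale c = Poly_Mapping.map ((*) (Poly_Mapping.single 0 c))"

definition free_variable :: "nat \<Rightarrow> (nat \<Rightarrow>\<^sub>0 (nat, 'k::comm_ring_1) mpoly) \<Rightarrow> (nat \<Rightarrow>\<^sub>0 (nat, 'k) mpoly)" where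
  "free_variable i = Poly_Mapping.map ((*) (mpoly_variable i))"

definition free_divide :: "nat \<Rightarrow> (nat \<Rightarrow>\<^sub>0 (nat, 'k::comm_ring_1) mpoly) \<Rightarrow> (nat \<Rightarrow>\<^sub>0 (nat, 'k) mpoly)" where
  "free_divide v = Poly_Mapping.map (divide_least_variable v)"

lemma lookup_map_zero: "f 0 = 0 \<Longrightarrow> lookup (Poly_Mapping.map f p) k = f (lookup p k)"
  by (simp add: Poly_Mapping.map.rep_eq when_def)

lemma poly_mapping_eq_sum: "p = (\<Sum>k\<in>keys p. Poly_Mapping.single k (lookup p k))"
  by (rule poly_mapping_eqI) (auto simp: lookup_sum lookup_single when_def in_keys_iff)

lemma lookup_single_mult:
  fixes p :: "'a::cancel_comm_monoid_add \<Rightarrow>\<^sub>0 'b::comm_ring_1"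
  shows "lookup (Poly_Mapping.single t c * p) (t + u) = c * lookup p u"
    and "\<nexists>u. k = t + u \<Longrightarrow> lookup (Poly_Mapping.single t c * p) k = 0"
proof -
  have *: "lookup (Poly_Mapping.single t c * p) k
      = (\<Sum>m\<in>keys p. c * lookup p m when k = t + m)" for k
    by (subst (1) poly_mapping_eq_sum[of p])
      (simp add: sum_distrib_left lookup_sum mult_single lookup_single eq_commute)
  show "lookup (Poly_Mapping.single t c * p) (t + u) = c * lookup p u"
    by (auto simp: * when_def in_keys_iff)
  show "\<nexists>u. k = t + u \<Longrightarrow> lookup (Poly_Mapping.single t c * p) k = 0"
    by (auto simp: * when_def)
qed

lemma single_le_split:
  fixes m :: "nat \<Rightarrow>\<^sub>0 nat"
  assumes "i \<in> keys m"
  shows "m = Poly_Mapping.single i 1 + (m - Poly_Mapping.single i 1)"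
  using assms by (intro poly_mapping_eqI)
    (auto simp: lookup_add lookup_minus lookup_single when_def in_keys_iff)

lemma lookup_variable_mult:
  "lookup (mpoly_variable i * p) m
    = (if i \<in> keys m then lookup p (m - Poly_Mapping.single i 1) else 0)"
proof (cases "i \<in> keys m")
  case True
  then show ?thesis
    unfolding mpoly_variable_def
    using lookup_single_mult(1)[of "Poly_Mapping.single i 1" 1 p "m - Poly_Mapping.single i 1"]
      single_le_split[OF True] by simp
next
  case False
  then have "\<nexists>u. m = Poly_Mapping.single i 1 + u"
    by (auto simp: in_keys_iff lookup_add)
  then show ?thesis
    unfolding mpoly_variable_def using False lookup_single_mult(2) by auto
qed

lemma lookup_divide_least_variable:
  "lookup (divide_least_variable v p) m
    = (if \<forall>w\<in>keys m. v \<le> w then lookup p (m + Poly_Mapping.single v 1) else 0)"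
proof -
  have inj: "inj (\<lambda>m. m + Poly_Mapping.single v (1::nat))" by (rule injI) simp
  have "lookup (Poly_Mapping.map_key (\<lambda>m. m + Poly_Mapping.single v 1) p) m
      = lookup p (m + Poly_Mapping.single v 1)"
    using map_key.rep_eq[OF inj, of p] by (simp add: fun_eq_iff)
  then show ?thesis
    by (auto simp: divide_least_variable_def lookup_mapp when_def in_keys_iff)
qed

lemma keys_add_single: "keys (m + Poly_Mapping.single v (1::nat)) = insert v (keys m)"
  by (auto simp: in_keys_iff lookup_add lookup_single when_def split: if_splits)

lemma keys_minus_single: "keys (m - Poly_Mapping.single v (1::nat)) \<subseteq> keys m"
  "keys m \<subseteq> insert v (keys (m - Poly_Mapping.single v (1::nat)))"
  by (auto simp: in_keys_iff lookup_minus lookup_single when_def split: if_splits)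

lemma divide_least_variable_mult_greater:
  assumes "v < w"
  shows "divide_least_variable v (mpoly_variable w * p) = mpoly_variable w * divide_least_variable v p"
proof (rule poly_mapping_eqI)
  fix m :: "nat \<Rightarrow>\<^sub>0 nat"
  have "(\<forall>x\<in>keys m. v \<le> x) \<longleftrightarrow> (\<forall>x\<in>keys (m - Poly_Mapping.single w 1). v \<le> x)"
    using keys_minus_single[of m w] assms by auto
  moreover have "m + Poly_Mapping.single v 1 - Poly_Mapping.single w 1
      = m - Poly_Mapping.single w 1 + Poly_Mapping.single v 1" if "w \<in> keys m"
    using that by (intro poly_mapping_eqI) (auto simp: lookup_add lookup_minus lookup_single when_def in_keys_iff)
  moreover have "w \<in> keys (m + Poly_Mapping.single v 1) \<longleftrightarrow> w \<in> keys m"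
    using assms by (auto simp: keys_add_single simp del: One_nat_def)
  ultimately show "lookup (divide_least_variable v (mpoly_variable w * p)) m
      = lookup (mpoly_variable w * divide_least_variable v p) m"
    by (simp add: lookup_divide_least_variable lookup_variable_mult)
qed

lemma divide_least_variable_mult_less:
  assumes "w < v"
  shows "divide_least_variable v (mpoly_variable w * p) = 0"
  by (rule poly_mapping_eqI)
    (use assms in \<open>auto simp: lookup_divide_least_variable lookup_variable_mult keys_add_single not_le
      simp del: One_nat_def\<close>)

text \<open>Monomials other than 1 are sorted by their least variable.\<close>

lemma lookup_variable_mult_divide:
  "lookup (mpoly_variable i * divide_least_variable i p) m
    = (if m \<noteq> 0 \<and> i = Min (keys m) then lookup p m else 0)"
proof (cases "i \<in> keys m \<and> (\<forall>w\<in>keys (m - Poly_Mapping.single i 1). i \<le> w)")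
  case True
  then have "\<forall>w\<in>keys m. i \<le> w" using keys_minus_single(2)[of m i] by auto
  then have "Min (keys m) = i" "m \<noteq> 0" using True by (auto intro: Min_eqI)
  then show ?thesis
    using True single_le_split[of i m] by (simp add: lookup_variable_mult lookup_divide_least_variable add.commute)
next
  case False
  have "\<not> (m \<noteq> 0 \<and> i = Min (keys m))"
  proof
    assume *: "m \<noteq> 0 \<and> i = Min (keys m)"
    then have "i \<in> keys m" "\<forall>w\<in>keys m. i \<le> w" using Min_in[of "keys m"] by auto
    then show False using False keys_minus_single(1)[of m i] by blast
  qed
  then show ?thesis using False by (auto simp: lookup_variable_mult lookup_divide_least_variable)
qed

lemma lookup_sum_variable_mult_divide:
  "lookup (\<Sum>i<v. mpoly_variable i * divide_least_variable i p) m
    = (if m \<noteq> 0 \<and> Min (keys m) < v then lookup p m else 0)"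
  by (auto simp: lookup_sum lookup_variable_mult_divide)

lemma divide_least_variable_mult_same:
  "divide_least_variable v (mpoly_variable v * p)
    + (\<Sum>i<v. mpoly_variable i * divide_least_variable i p) = p"
proof (rule poly_mapping_eqI)
  fix m :: "nat \<Rightarrow>\<^sub>0 nat"
  have "(\<forall>w\<in>keys m. v \<le> w) \<longleftrightarrow> \<not> (m \<noteq> 0 \<and> Min (keys m) < v)"
  proof (cases "m = 0")
    case False
    then show ?thesis by (simp add: not_less)
  qed simp
  then show "lookup (divide_least_variable v (mpoly_variable v * p)
      + (\<Sum>i<v. mpoly_variable i * divide_least_variable i p)) m = lookup p m"
    unfolding lookup_add lookup_sum_variable_mult_divide
    by (simp add: lookup_divide_least_variable lookup_variable_mult keys_add_single del: One_nat_def)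
qed

lemma divide_least_variable_0: "divide_least_variable v 0 = 0"
  by (rule poly_mapping_eqI) (simp add: lookup_divide_least_variable)

lemma divide_least_variable_add:
  "divide_least_variable v (p + q) = divide_least_variable v p + divide_least_variable v q"
  by (rule poly_mapping_eqI) (simp add: lookup_divide_least_variable lookup_add)

lemma lookup_free_scale: "lookup (free_scale c f) j = Poly_Mapping.single 0 c * lookup f j"
  and lookup_free_variable: "lookup (free_variable i f) j = mpoly_variable i * lookup f j"
  and lookup_free_divide: "lookup (free_divide i f) j = divide_least_variable i (lookup f j)"
  by (simp_all add: free_scale_def free_variable_def free_divide_def lookup_map_zero
      divide_least_variable_0)

lemma lookup_scale:
  fixes p :: "'a::cancel_comm_monoid_add \<Rightarrow>\<^sub>0 'b::comm_ring_1"
  shows "lookup (Poly_Mapping.single 0 c * p) m = c * lookup p m"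
  using lookup_single_mult(1)[of 0 c p m] by simp

lemma vector_space_free_scale: "vector_space (free_scale :: 'k::field \<Rightarrow> _)"
  by unfold_locales
    (auto intro!: poly_mapping_eqI simp: lookup_free_scale lookup_scale lookup_add distrib_left distrib_right)

lemma monom_degree_superset:
  assumes "finite A" "keys m \<subseteq> A"
  shows "monom_degree C m = (\<Sum>i\<in>A. frag_cmul (int (lookup m i)) (C i))"
  unfolding monom_degree_def
  by (rule sum.mono_neutral_left) (use assms in \<open>auto simp: in_keys_iff\<close>)

lemma monom_degree_add_single: "monom_degree C (m + Poly_Mapping.single v 1) = monom_degree C m + C v"
proof -
  have "monom_degree C (m + Poly_Mapping.single v 1)
      = (\<Sum>i\<in>insert v (keys m). frag_cmul (int (lookup m i)) (C i) + (if i = v then C v else 0))"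
    unfolding monom_degree_def keys_add_single
    by (rule sum.cong) (auto simp: lookup_add lookup_single when_def frag_cmul_distrib)
  also have "\<dots> = monom_degree C m + C v"
    by (simp add: sum.distrib monom_degree_superset[of "insert v (keys m)" m C] subset_insertI
        del: sum.insert)
  finally show ?thesis .
qed

lemma monom_degree_0: "monom_degree C 0 = 0"
  by (simp add: monom_degree_def)

lemma degree_group_diff: "a \<in> degree_group r \<Longrightarrow> b \<in> degree_group r \<Longrightarrow> a - b \<in> degree_group r"
  using keys_diff[of a b] by (auto simp: degree_group_def)

lemma degree_group_add: "a \<in> degree_group r \<Longrightarrow> b \<in> degree_group r \<Longrightarrow> a + b \<in> degree_group r"
  using Poly_Mapping.keys_add[of a b] by (auto simp: degree_group_def)

lemma monom_degree_mem:
  assumes "\<And>i. i < n \<Longrightarrow> C i \<in> degree_group r" "keys m \<subseteq> {..<n}"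
  shows "monom_degree C m \<in> degree_group r"
proof -
  have "keys (monom_degree C m) \<subseteq> (\<Union>i\<in>keys m. keys (frag_cmul (int (lookup m i)) (C i)))"
    unfolding monom_degree_def by (rule keys_sum)
  also have "\<dots> \<subseteq> (\<Union>i\<in>keys m. keys (C i))" using keys_cmul by blast
  also have "\<dots> \<subseteq> {..<r}" using assms unfolding degree_group_def by blast
  finally show ?thesis by (simp add: degree_group_def)
qed

lemma mem_poly_ring_iff: "p \<in> poly_ring n \<longleftrightarrow> (\<forall>m. lookup p m \<noteq> 0 \<longrightarrow> keys m \<subseteq> {..<n})"
  unfolding poly_ring_def in_keys_iff Ball_def mem_Collect_eq ..

lemma mem_poly_piece_iff:
  "p \<in> poly_piece n C d \<longleftrightarrow> (\<forall>m. lookup p m \<noteq> 0 \<longrightarrow> keys m \<subseteq> {..<n} \<and> monom_degree C m = d)"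
  unfolding poly_piece_def mem_poly_ring_iff in_keys_iff Ball_def mem_Collect_eq by blast

lemma mem_free_piece_iff:
  "f \<in> free_piece n C b e d \<longleftrightarrow> (\<forall>j m. lookup (lookup f j) m \<noteq> 0 \<longrightarrow>
     j < b \<and> keys m \<subseteq> {..<n} \<and> monom_degree C m = d - e j)"
proof -
  have "keys f \<subseteq> {..<b} \<longleftrightarrow> (\<forall>j m. lookup (lookup f j) m \<noteq> 0 \<longrightarrow> j < b)"
    by (auto simp: in_keys_iff subset_iff poly_mapping_eq_iff[of _ 0] fun_eq_iff)
  then show ?thesis
    unfolding free_piece_def free_module_def mem_poly_piece_iff mem_poly_ring_iff mem_Collect_eq
    by blast
qed

lemma subspace_free_piece:
  "module.subspace free_scale (free_piece n C b e d :: (nat \<Rightarrow>\<^sub>0 (nat, 'k::field) mpoly) set)"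
proof -
  interpret vector_space "free_scale :: 'k \<Rightarrow> _" by (rule vector_space_free_scale)
  show ?thesis
  proof (rule subspaceI)
    fix f g :: "nat \<Rightarrow>\<^sub>0 (nat, 'k) mpoly" and c
    assume f: "f \<in> free_piece n C b e d" and g: "g \<in> free_piece n C b e d"
    have "lookup (lookup f j) m \<noteq> 0 \<or> lookup (lookup g j) m \<noteq> 0"
      if "lookup (lookup (f + g) j) m \<noteq> 0" for j m using that by (auto simp: lookup_add)
    then show "f + g \<in> free_piece n C b e d" using f g unfolding mem_free_piece_iff by blast
  next
    fix f :: "nat \<Rightarrow>\<^sub>0 (nat, 'k) mpoly" and c
    assume f: "f \<in> free_piece n C b e d"
    have "lookup (lookup f j) m \<noteq> 0"
      if "lookup (lookup (free_scale c f) j) m \<noteq> 0" for j m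
      using that by (auto simp: lookup_free_scale lookup_scale)
    then show "free_scale c f \<in> free_piece n C b e d" using f unfolding mem_free_piece_iff by blast
  qed (simp add: mem_free_piece_iff)
qed

lemma contractible_free_module:
  assumes C: "\<And>i. i < n \<Longrightarrow> C i \<in> degree_group r"
  shows "contractible_module free_scale (degree_group r) n C free_variable
    (free_piece n C b e :: _ \<Rightarrow> (nat \<Rightarrow>\<^sub>0 (nat, 'k::field) mpoly) set) free_divide"
proof -
  interpret vector_space "free_scale :: 'k \<Rightarrow> _" by (rule vector_space_free_scale)
  show ?thesis
  proof
    show "d - C i \<in> degree_group r" if "d \<in> degree_group r" "i < n" for d i
      using that C degree_group_diff by blast
    show "subspace (free_piece n C b e d :: (nat \<Rightarrow>\<^sub>0 (nat, 'k) mpoly) set)" for d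
      by (rule subspace_free_piece)
    show "free_variable i v \<in> free_piece n C b e d" if "v \<in> free_piece n C b e (d - C i)" "i < n"
      for d i and v :: "nat \<Rightarrow>\<^sub>0 (nat, 'k) mpoly"
      unfolding mem_free_piece_iff
    proof (intro allI impI)
      fix j m assume "lookup (lookup (free_variable i v) j) m \<noteq> 0"
      then have i: "i \<in> keys m" and nz: "lookup (lookup v j) (m - Poly_Mapping.single i 1) \<noteq> 0"
        by (auto simp: lookup_free_variable lookup_variable_mult split: if_splits)
      from nz that(1) have "j < b \<and> keys (m - Poly_Mapping.single i 1) \<subseteq> {..<n}
          \<and> monom_degree C (m - Poly_Mapping.single i 1) = d - C i - e j"
        unfolding mem_free_piece_iff by blast
      moreover have "monom_degree C m = monom_degree C (m - Poly_Mapping.single i 1) + C i"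
        using monom_degree_add_single[of C "m - Poly_Mapping.single i 1" i] single_le_split[OF i]
        by (simp add: add.commute)
      ultimately show "j < b \<and> keys m \<subseteq> {..<n} \<and> monom_degree C m = d - e j"
        using keys_minus_single(2)[of m i] that(2) by auto
    qed
    show "free_divide v y \<in> free_piece n C b e (d - C v)" if "y \<in> free_piece n C b e d"
      for d v and y :: "nat \<Rightarrow>\<^sub>0 (nat, 'k) mpoly"
      unfolding mem_free_piece_iff
    proof (intro allI impI)
      fix j m assume "lookup (lookup (free_divide v y) j) m \<noteq> 0"
      then have "lookup (lookup y j) (m + Poly_Mapping.single v 1) \<noteq> 0"
        by (auto simp: lookup_free_divide lookup_divide_least_variable split: if_splits)
      with that have "j < b \<and> keys (m + Poly_Mapping.single v 1) \<subseteq> {..<n}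
          \<and> monom_degree C (m + Poly_Mapping.single v 1) = d - e j"
        unfolding mem_free_piece_iff by blast
      then show "j < b \<and> keys m \<subseteq> {..<n} \<and> monom_degree C m = d - C v - e j"
        unfolding keys_add_single monom_degree_add_single by (auto simp: algebra_simps)
    qed
  next
    fix v and y :: "nat \<Rightarrow>\<^sub>0 (nat, 'k) mpoly"
    show "free_divide v (free_variable v y) + (\<Sum>i<v. free_variable i (free_divide i y)) = y"
      by (rule poly_mapping_eqI)
        (simp add: lookup_add lookup_sum lookup_free_variable lookup_free_divide
          divide_least_variable_mult_same)
  qed (rule poly_mapping_eqI, simp add: lookup_free_variable lookup_free_divide lookup_free_scale
      lookup_add distrib_left mult.left_commute divide_least_variable_add
      divide_least_variable_mult_greater divide_least_variable_mult_less)+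
qed

text \<open>The boundaries in degree 0 are the elements of \<open>(x\<^sub>1, \<dots>, x\<^sub>n) F\<close>, which are those without constant
  coefficients.\<close>

lemma koszul_boundaries_free_iff:
  fixes a :: "nat set \<Rightarrow> nat \<Rightarrow>\<^sub>0 (nat, 'k::field) mpoly"
  assumes C: "\<And>i. i < n \<Longrightarrow> C i \<in> degree_group r" and d: "d \<in> degree_group r"
    and a: "a \<in> koszul_chains n C (free_piece n C b e) d 0"
  shows "a \<in> koszul_boundaries n C free_variable (free_piece n C b e) d 0
    \<longleftrightarrow> (\<forall>j. lookup (lookup (a {}) j) 0 = 0)"
proof -
  interpret contractible_module free_scale "degree_group r" n C free_variable
    "free_piece n C b e :: _ \<Rightarrow> (nat \<Rightarrow>\<^sub>0 (nat, 'k) mpoly) set" free_divide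
    by (rule contractible_free_module) (rule C)
  show ?thesis
  proof
    assume "a \<in> koszul_boundaries n C free_variable (free_piece n C b e) d 0"
    then obtain c where "a = koszul_diff n free_variable c" unfolding koszul_boundaries_def by auto
    then have "a {} = (\<Sum>i<n. free_variable i (c {i}))" by (simp add: koszul_diff_def signed_def)
    then show "\<forall>j. lookup (lookup (a {}) j) 0 = 0"
      by (simp add: lookup_sum lookup_free_variable lookup_variable_mult)
  next
    assume zero: "\<forall>j. lookup (lookup (a {}) j) 0 = 0"
    show "a \<in> koszul_boundaries n C free_variable (free_piece n C b e) d 0"
    proof (rule koszul_boundaries_0[OF d a], intro poly_mapping_eqI)
      fix j and m :: "nat \<Rightarrow>\<^sub>0 nat"
      have "a {} \<in> free_piece n C b e d"
        using a unfolding koszul_chains_def by (auto dest!: spec[of _ "{}"])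
      then have "m \<noteq> 0 \<and> Min (keys m) < n" if "lookup (lookup (a {}) j) m \<noteq> 0"
        using that zero Min_in[of "keys m"] unfolding mem_free_piece_iff by fastforce
      then have "lookup (lookup (a {}) j) m = (if m \<noteq> 0 \<and> Min (keys m) < n then lookup (lookup (a {}) j) m else 0)"
        by auto
      then show "lookup (lookup (\<Sum>i<n. free_variable i (free_divide i (a {}))) j) m
          = lookup (lookup (a {}) j) m"
        unfolding lookup_sum_variable_mult_divide[symmetric]
        by (simp add: lookup_sum lookup_free_variable lookup_free_divide)
    qed
  qed
qed

definition irrelevant_piece :: "nat \<Rightarrow> (nat \<Rightarrow> nat \<Rightarrow>\<^sub>0 int) \<Rightarrow> nat \<Rightarrow> (nat \<Rightarrow> nat \<Rightarrow>\<^sub>0 int) \<Rightarrow> (nat \<Rightarrow>\<^sub>0 int)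
    \<Rightarrow> (nat \<Rightarrow>\<^sub>0 (nat, 'k::comm_ring_1) mpoly) set" where
  "irrelevant_piece n C b e d = {f \<in> free_piece n C b e d. \<forall>j. lookup (lookup f j) 0 = 0}"

lemma koszul_homology_0_free:
  assumes C: "\<And>i. i < n \<Longrightarrow> C i \<in> degree_group r" and d: "d \<in> degree_group r"
  shows "isomorphic_quotients
    (pointwise_scale (free_scale :: 'k::field \<Rightarrow> _)) (koszul_cycles n C free_variable (free_piece n C b e) d 0)
      (koszul_boundaries n C free_variable (free_piece n C b e) d 0)
    free_scale (free_piece n C b e d) (irrelevant_piece n C b e d)"
proof -
  interpret contractible_module free_scale "degree_group r" n C free_variable
    "free_piece n C b e :: _ \<Rightarrow> (nat \<Rightarrow>\<^sub>0 (nat, 'k) mpoly) set" free_divide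
    by (rule contractible_free_module) (rule C)
  let ?K = "koszul_chains n C (free_piece n C b e :: _ \<Rightarrow> (nat \<Rightarrow>\<^sub>0 (nat, 'k) mpoly) set) d 0"
  have cyc: "koszul_cycles n C free_variable (free_piece n C b e) d 0 = ?K"
    using koszul_diff_chains_0 by (auto simp: koszul_cycles_def)
  have K: "a {} \<in> free_piece n C b e d" if "a \<in> ?K" for a
    using that unfolding koszul_chains_def by (auto dest!: spec[of _ "{}"])
  have "linear_correspondence (pointwise_scale free_scale) ?K
      (koszul_boundaries n C free_variable (free_piece n C b e) d 0)
    free_scale (free_piece n C b e d) (irrelevant_piece n C b e d) (\<lambda>a f. a \<in> ?K \<and> f = a {})"
    unfolding linear_correspondence_def
  proof (intro conjI allI impI ballI; (elim conjE)?)
    fix f :: "nat \<Rightarrow>\<^sub>0 (nat, 'k) mpoly" assume f: "f \<in> free_piece n C b e d"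
    have "S = {}" if "S \<subseteq> {..<n}" "card S = 0" for S
      using that finite_subset[of S "{..<n}"] by simp
    then have "(\<lambda>S. if S = {} then f else 0) \<in> ?K"
      using f by (auto simp: koszul_chains_def)
    then show "\<exists>a. a \<in> ?K \<and> f = a {}" 
      by (intro exI[of _ "\<lambda>S. if S = {} then f else 0"]) simp
  next
    fix a f assume "a \<in> ?K" "f = a {}"
    then show "a \<in> koszul_boundaries n C free_variable (free_piece n C b e) d 0
        \<longleftrightarrow> f \<in> irrelevant_piece n C b e d"
      using K koszul_boundaries_free_iff[OF C d] by (simp add: irrelevant_piece_def)
  next
    fix c a f assume "a \<in> ?K" "f = a {}"
    then show "pointwise_scale free_scale c a \<in> ?K"
        and "free_scale c f = pointwise_scale free_scale c a {}"
      by (simp_all add: chains_scale[OF d]) (simp add: pointwise_scale_def)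
  qed (use K in \<open>simp_all add: chains_diff[OF d]\<close>)
  then show ?thesis unfolding cyc isomorphic_quotients_def by blast
qed

text \<open>Modulo \<open>(x\<^sub>1, \<dots>, x\<^sub>n)\<close> only constant coefficients survive, and a homogeneous element of degree \<open>d\<close> has a
  constant coefficient only at generators of degree \<open>d\<close>.\<close>

lemma basis_modulo_irrelevant_piece:
  "basis_modulo (free_scale :: 'k::field \<Rightarrow> _) (free_piece n C b e d) (irrelevant_piece n C b e d)
     ((\<lambda>j. Poly_Mapping.single j 1) ` {j. j < b \<and> e j = d})"
    (is "basis_modulo _ _ _ ?B")
  and card_basis_irrelevant_piece: "card ((\<lambda>j. Poly_Mapping.single j (1 :: (nat, 'k) mpoly)) ` {j. j < b \<and> e j = d})
     = card {j. j < b \<and> e j = d}"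
proof -
  let ?J = "{j. j < b \<and> e j = d}"
  let ?u = "\<lambda>j. Poly_Mapping.single j (1 :: (nat, 'k) mpoly)"
  have u_inj: "?u j = ?u j' \<longleftrightarrow> j = j'" for j j'
    by (metis lookup_single_eq lookup_single_not_eq zero_neq_one)
  have inj: "inj_on ?u ?J" by (rule inj_onI) (simp only: u_inj)
  then show "card (?u ` ?J) = card ?J" by (rule card_image)
  have piece: "?u j \<in> free_piece n C b e d" if "j \<in> ?J" for j
    using that unfolding mem_free_piece_iff
    by (auto simp: lookup_single lookup_one monom_degree_0 when_def split: if_splits)
  interpret vector_space "free_scale :: 'k \<Rightarrow> _" by (rule vector_space_free_scale)
  have coeff: "lookup (lookup (f - (\<Sum>b\<in>?B. free_scale (c b) b)) j) 0
      = lookup (lookup f j) 0 - (if j \<in> ?J then c (?u j) else 0)" for f c j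
  proof -
    have "lookup (lookup (\<Sum>b\<in>?B. free_scale (c b) b) j) 0
        = (\<Sum>i\<in>?J. if i = j then c (?u j) else 0)"
      unfolding sum.reindex[OF inj] lookup_sum
      by (rule sum.cong) (auto simp: lookup_free_scale lookup_scale lookup_single when_def)
    then show ?thesis by (simp add: lookup_minus)
  qed
  have const_0: "lookup (lookup f j) 0 = 0" if "f \<in> free_piece n C b e d" "j \<notin> ?J" for f j
  proof (rule ccontr)
    assume "lookup (lookup f j) 0 \<noteq> 0"
    then have "j < b \<and> monom_degree C 0 = d - e j" using that(1) unfolding mem_free_piece_iff by blast
    then show False using that(2) by (simp add: monom_degree_0)
  qed
  show "basis_modulo (free_scale :: 'k \<Rightarrow> _) (free_piece n C b e d) (irrelevant_piece n C b e d) ?B"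
    unfolding basis_modulo_def
  proof (intro conjI ballI)
    show "finite ?B" by simp
    show "?B \<subseteq> free_piece n C b e d" using piece by blast
    fix f :: "nat \<Rightarrow>\<^sub>0 (nat, 'k) mpoly" assume f: "f \<in> free_piece n C b e d"
    have sub: "subspace (free_piece n C b e d :: (nat \<Rightarrow>\<^sub>0 (nat, 'k) mpoly) set)"
      by (rule subspace_free_piece)
    have rest: "f - (\<Sum>b\<in>?B. free_scale (c b) b) \<in> free_piece n C b e d" for c
      using piece by (intro subspace_diff[OF sub f] subspace_sum[OF sub] subspace_scale[OF sub]) auto
    have mem: "f - (\<Sum>b\<in>?B. free_scale (c b) b) \<in> irrelevant_piece n C b e d
      \<longleftrightarrow> (\<forall>j\<in>?J. c (?u j) = lookup (lookup f j) 0)" for c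
      using rest[of c] const_0[OF f] unfolding irrelevant_piece_def mem_Collect_eq coeff by auto
    define c where "c g = (if g \<in> ?B then lookup (lookup f (the_inv_into ?J ?u g)) 0 else 0)" for g
    have cu: "c (?u j) = lookup (lookup f j) 0" if "j \<in> ?J" for j
      using that the_inv_into_f_f[OF inj that] unfolding c_def by auto
    show "\<exists>!c. (\<forall>g. g \<notin> ?B \<longrightarrow> c g = 0)
      \<and> f - (\<Sum>b\<in>?B. free_scale (c b) b) \<in> irrelevant_piece n C b e d"
      unfolding mem
    proof (intro ex1I[of _ c] conjI ballI allI impI)
      fix c' assume c': "(\<forall>g. g \<notin> ?B \<longrightarrow> c' g = 0) \<and> (\<forall>j\<in>?J. c' (?u j) = lookup (lookup f j) 0)"
      show "c' = c"
      proof
        fix g show "c' g = c g"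
        proof (cases "g \<in> ?B")
          case True then show ?thesis using c' cu by auto
        next
          case False then show ?thesis using c' by (simp add: c_def)
        qed
      qed
    qed (use cu in \<open>auto simp: c_def\<close>)
  qed
qed

lemma mem_free_module_iff:
  "f \<in> free_module n b \<longleftrightarrow> (\<forall>j m. lookup (lookup f j) m \<noteq> 0 \<longrightarrow> j < b \<and> keys m \<subseteq> {..<n})"
proof -
  have "keys f \<subseteq> {..<b} \<longleftrightarrow> (\<forall>j m. lookup (lookup f j) m \<noteq> 0 \<longrightarrow> j < b)"
    by (auto simp: in_keys_iff subset_iff poly_mapping_eq_iff[of _ 0] fun_eq_iff)
  then show ?thesis
    unfolding free_module_def mem_poly_ring_iff mem_Collect_eq by blast
qed

lemma free_module_add:
  assumes "f \<in> free_module n b" "g \<in> free_module n b" shows "f + g \<in> free_module n b"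
proof -
  have "lookup (lookup f j) m \<noteq> 0 \<or> lookup (lookup g j) m \<noteq> 0"
    if "lookup (lookup (f + g) j) m \<noteq> 0" for j m using that by (auto simp: lookup_add)
  then show ?thesis using assms unfolding mem_free_module_iff by blast
qed

lemma free_piece_subset: "free_piece n C b e d \<subseteq> free_module n b"
  by (auto simp: free_piece_def)

lemma sum_closed:
  assumes "Q 0" "\<And>f g. Q f \<Longrightarrow> Q g \<Longrightarrow> Q (f + g)" "\<And>x. x \<in> A \<Longrightarrow> Q (h x)"
  shows "Q (sum h A)"
  using assms(3) by (induction A rule: infinite_finite_induct) (simp_all add: assms(1,2))

lemma single_sum: "Poly_Mapping.single j (sum h A) = (\<Sum>x\<in>A. Poly_Mapping.single j (h x))"
  by (rule poly_mapping_eqI) (auto simp: lookup_sum lookup_single when_def)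

text \<open>A free module is the sum of its pieces, so that statements about an additive map can be reduced to
  homogeneous elements.\<close>

lemma free_module_induct [consumes 1, case_names degrees shifts zero add homogeneous]:
  assumes f: "f \<in> free_module n b"
    and C: "\<And>i. i < n \<Longrightarrow> C i \<in> degree_group r" and e: "\<And>j. j < b \<Longrightarrow> e j \<in> degree_group r"
    and zero: "P 0"
    and add: "\<And>f g. f \<in> free_module n b \<Longrightarrow> g \<in> free_module n b \<Longrightarrow> P f \<Longrightarrow> P g \<Longrightarrow> P (f + g)"
    and homogeneous: "\<And>d f. d \<in> degree_group r \<Longrightarrow> f \<in> free_piece n C b e d \<Longrightarrow> P f"
  shows "P f"
proof -
  let ?Q = "\<lambda>f. f \<in> free_module n b \<and> P f"
  have Q0: "?Q 0" by (simp add: zero mem_free_module_iff)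
  have Q_add: "?Q (f + g)" if "?Q f" "?Q g" for f g using that add free_module_add by blast
  have Q: "?Q (\<Sum>j\<in>keys f. \<Sum>m\<in>keys (lookup f j).
      Poly_Mapping.single j (Poly_Mapping.single m (lookup (lookup f j) m)))"
  proof (intro sum_closed[of ?Q, OF Q0 Q_add])
    fix j m assume "j \<in> keys f" "m \<in> keys (lookup f j)"
    then have nz: "lookup (lookup f j) m \<noteq> 0" by (simp add: in_keys_iff)
    then have jm: "j < b" "keys m \<subseteq> {..<n}" using f unfolding mem_free_module_iff by blast+
    have "monom_degree C m + e j \<in> degree_group r"
      using jm by (intro degree_group_add monom_degree_mem C e)
    moreover have "Poly_Mapping.single j (Poly_Mapping.single m (lookup (lookup f j) m))
        \<in> free_piece n C b e (monom_degree C m + e j)"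
      using jm unfolding mem_free_piece_iff by (auto simp: lookup_single when_def split: if_splits)
    ultimately show "?Q (Poly_Mapping.single j (Poly_Mapping.single m (lookup (lookup f j) m)))"
      using homogeneous free_piece_subset by blast
  qed
  have eq: "(\<Sum>j\<in>keys f. \<Sum>m\<in>keys (lookup f j).
      Poly_Mapping.single j (Poly_Mapping.single m (lookup (lookup f j) m))) = f"
  proof -
    have "(\<Sum>m\<in>keys (lookup f j). Poly_Mapping.single j (Poly_Mapping.single m (lookup (lookup f j) m)))
        = Poly_Mapping.single j (lookup f j)" for j
      using arg_cong[OF poly_mapping_eq_sum[of "lookup f j"], of "Poly_Mapping.single j"]
      unfolding single_sum by (rule sym)
    then show ?thesis using poly_mapping_eq_sum[of f, symmetric] by (simp only:)
  qed
  show ?thesis using Q unfolding eq ..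
qed


section \<open>Evaluation of polynomials\<close>

lemma mpoly_eval_superset:
  assumes "finite A" "keys p \<subseteq> A" "c 0 = 0"
  shows "mpoly_eval c a p = (\<Sum>m\<in>A. c (lookup p m) * (\<Prod>v\<in>keys m. a v ^ lookup m v))"
  unfolding mpoly_eval_def
  by (rule sum.mono_neutral_left) (use assms in \<open>auto simp: in_keys_iff\<close>)

lemma mpoly_eval_add:
  fixes c :: "'k::comm_ring_1 \<Rightarrow> 'b::comm_ring_1"
  assumes "c 0 = 0" "\<And>s t. c (s + t) = c s + c t"
  shows "mpoly_eval c a (p + q) = mpoly_eval c a p + mpoly_eval c a q"
proof -
  let ?A = "keys p \<union> keys q"
  have "keys (p + q) \<subseteq> ?A" by (rule Poly_Mapping.keys_add)
  then show ?thesis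
    by (simp add: mpoly_eval_superset[of ?A] assms lookup_add distrib_right sum.distrib)
qed

lemma mpoly_eval_scale:
  fixes c :: "'k::comm_ring_1 \<Rightarrow> 'b::comm_ring_1"
  assumes "c 0 = 0" "\<And>s t. c (s * t) = c s * c t"
  shows "mpoly_eval c a (Poly_Mapping.single 0 t * p) = c t * mpoly_eval c a p"
proof -
  have "keys (Poly_Mapping.single 0 t * p) \<subseteq> keys p" by (auto simp: in_keys_iff lookup_scale)
  then show ?thesis
    by (simp add: mpoly_eval_superset[of "keys p"] assms lookup_scale sum_distrib_left mult.assoc)
qed

lemma prod_keys_add_single:
  fixes a :: "nat \<Rightarrow> 'b::comm_ring_1"
  shows "(\<Prod>v\<in>keys (m + Poly_Mapping.single i 1). a v ^ lookup (m + Poly_Mapping.single i 1) v)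
    = a i * (\<Prod>v\<in>keys m. a v ^ lookup m v)"
proof -
  have "(\<Prod>v\<in>keys (m + Poly_Mapping.single i 1). a v ^ lookup (m + Poly_Mapping.single i 1) v)
      = (\<Prod>v\<in>insert i (keys m). (if v = i then a i else 1) * a v ^ lookup m v)"
    unfolding keys_add_single
    by (rule prod.cong) (auto simp: lookup_add lookup_single when_def)
  also have "\<dots> = a i * (\<Prod>v\<in>insert i (keys m). a v ^ lookup m v)"
    by (simp add: prod.distrib del: prod.insert)
  also have "(\<Prod>v\<in>insert i (keys m). a v ^ lookup m v) = (\<Prod>v\<in>keys m. a v ^ lookup m v)"
    by (rule prod.mono_neutral_right) (auto simp: in_keys_iff)
  finally show ?thesis .
qed

lemma mpoly_eval_variable:
  fixes c :: "'k::comm_ring_1 \<Rightarrow> 'b::comm_ring_1"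
  assumes "c 0 = 0"
  shows "mpoly_eval c a (mpoly_variable i * p) = a i * mpoly_eval c a p"
proof -
  let ?s = "\<lambda>m. m + Poly_Mapping.single i (1::nat)"
  have inj: "inj_on ?s (keys p)" by (rule inj_onI) simp
  have look: "lookup (mpoly_variable i * p) (?s m) = lookup p m" for m
    using lookup_single_mult(1)[of "Poly_Mapping.single i 1" 1 p m]
    by (simp add: mpoly_variable_def add.commute)
  have "keys (mpoly_variable i * p) \<subseteq> ?s ` keys p"
  proof
    fix m assume "m \<in> keys (mpoly_variable i * p)"
    then have "i \<in> keys m" "m - Poly_Mapping.single i 1 \<in> keys p"
      by (auto simp: in_keys_iff[of _ "mpoly_variable i * p"] lookup_variable_mult in_keys_iff[of _ p]
          split: if_splits)
    then show "m \<in> ?s ` keys p" using single_le_split[of i m] by (metis add.commute imageI)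
  qed
  then have "mpoly_eval c a (mpoly_variable i * p)
      = (\<Sum>m\<in>keys p. c (lookup p m) * (a i * (\<Prod>v\<in>keys m. a v ^ lookup m v)))"
    by (simp add: mpoly_eval_superset[of "?s ` keys p"] assms sum.reindex[OF inj] look
        prod_keys_add_single del: One_nat_def)
  also have "\<dots> = a i * mpoly_eval c a p"
    by (simp add: mpoly_eval_def sum_distrib_left mult.left_commute)
  finally show ?thesis .
qed

lemma poly_ring_add: "p \<in> poly_ring n \<Longrightarrow> q \<in> poly_ring n \<Longrightarrow> p + q \<in> poly_ring n"
  using Poly_Mapping.keys_add[of p q] by (auto simp: poly_ring_def)

lemma poly_ring_scale: "p \<in> poly_ring n \<Longrightarrow> Poly_Mapping.single 0 t * p \<in> poly_ring n"
  unfolding mem_poly_ring_iff lookup_scale by (metis mult_zero_right)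

lemma poly_ring_variable_mult:
  assumes "p \<in> poly_ring n" "i < n"
  shows "mpoly_variable i * p \<in> poly_ring n"
  unfolding mem_poly_ring_iff
proof (intro allI impI)
  fix m assume "lookup (mpoly_variable i * p) m \<noteq> 0"
  then have "lookup p (m - Poly_Mapping.single i 1) \<noteq> 0"
    by (auto simp: lookup_variable_mult split: if_splits)
  then have "keys (m - Poly_Mapping.single i 1) \<subseteq> {..<n}" using assms unfolding mem_poly_ring_iff by blast
  then show "keys m \<subseteq> {..<n}" using keys_minus_single(2)[of m i] assms(2) by auto
qed

lemma poly_ring_constant: "Poly_Mapping.single 0 t \<in> poly_ring n"
  unfolding mem_poly_ring_iff by (auto simp: lookup_single when_def)

lemma poly_ring_variable: "i < n \<Longrightarrow> mpoly_variable i \<in> poly_ring n"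
  unfolding mem_poly_ring_iff mpoly_variable_def by (auto simp: lookup_single when_def split: if_splits)


section \<open>The Cox ring as a graded module\<close>

text \<open>The algebraic structure of the spaces of sections is read off from the presentation: the Cox ring is the
  image of the polynomial ring under a homomorphism, hence closed under sums and under
  multiplication by scalars and by the \<open>x i\<close>, and a space of sections consists of the
  coefficients of its elements in one degree.\<close>

locale presented_cox_ring =
  fixes X :: "('v::finite \<Rightarrow> 'k::alg_closed_field) set"
    and \<iota> :: "'k \<Rightarrow> 'K::field" and \<xi> :: "'v \<Rightarrow> 'K"
    and r :: nat and D :: "nat \<Rightarrow> ('v \<Rightarrow> 'k) \<Rightarrow> 'K"
    and n :: nat and C :: "nat \<Rightarrow> nat \<Rightarrow>\<^sub>0 int" and x :: "nat \<Rightarrow> 'K"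
  assumes embedding: "field_embedding \<iota>" and presentation: "cox_presentation X \<iota> \<xi> r D n C x"
begin

definition sections :: "(nat \<Rightarrow>\<^sub>0 int) \<Rightarrow> 'K set" where
  "sections d = global_sections X \<iota> \<xi> (divisor_comb r D d)"

lemma iota_add: "\<iota> (a + b) = \<iota> a + \<iota> b" and iota_mult: "\<iota> (a * b) = \<iota> a * \<iota> b" and iota_1: "\<iota> 1 = 1"
  using embedding unfolding field_embedding_def by auto

lemma iota_0: "\<iota> 0 = 0" using iota_add[of 0 0] by (metis add.right_neutral add_left_imp_eq)

lemma C_mem: "i < n \<Longrightarrow> C i \<in> degree_group r"
  using presentation unfolding cox_presentation_def by blast

lemma cox_ring_eq: "cox_ring X \<iota> \<xi> r D = cox_map \<iota> C x ` poly_ring n"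
  using presentation unfolding cox_presentation_def by simp

lemma cox_map_add: "cox_map \<iota> C x (p + q) = cox_map \<iota> C x p + cox_map \<iota> C x q"
  unfolding cox_map_def by (rule mpoly_eval_add) (simp_all add: iota_0 iota_add single_add)

lemma cox_map_scale:
  "cox_map \<iota> C x (Poly_Mapping.single 0 t * p) = Poly_Mapping.single 0 (\<iota> t) * cox_map \<iota> C x p"
  unfolding cox_map_def by (rule mpoly_eval_scale) (simp_all add: iota_0 iota_mult mult_single)

lemma cox_map_variable_mult:
  "cox_map \<iota> C x (mpoly_variable i * p) = Poly_Mapping.single (C i) (x i) * cox_map \<iota> C x p"
  unfolding cox_map_def by (rule mpoly_eval_variable) (simp add: iota_0)

lemma cox_map_1: "cox_map \<iota> C x 1 = 1"
  by (simp add: cox_map_def mpoly_eval_def iota_1)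

lemma cox_map_constant: "cox_map \<iota> C x (Poly_Mapping.single 0 t) = Poly_Mapping.single 0 (\<iota> t)"
  using cox_map_scale[of t 1] by (simp add: cox_map_1)

lemma cox_map_variable: "cox_map \<iota> C x (mpoly_variable i) = Poly_Mapping.single (C i) (x i)"
  using cox_map_variable_mult[of i 1] by (simp add: cox_map_1)

lemma sections_0: "d \<in> degree_group r \<Longrightarrow> 0 \<in> sections d"
proof -
  have "0 \<in> cox_ring X \<iota> \<xi> r D"
    unfolding cox_ring_eq
    by (rule image_eqI[of _ _ 0]) (simp_all add: cox_map_def mpoly_eval_def poly_ring_def)
  then show "d \<in> degree_group r \<Longrightarrow> 0 \<in> sections d" by (auto simp: cox_ring_def sections_def)
qed

lemma single_mem_cox_ring_iff:
  "d \<in> degree_group r \<Longrightarrow> Poly_Mapping.single d s \<in> cox_ring X \<iota> \<xi> r D \<longleftrightarrow> s \<in> sections d"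
  using sections_0 unfolding cox_ring_def sections_def by (auto simp: lookup_single when_def)

lemma cox_ring_add:
  "f \<in> cox_ring X \<iota> \<xi> r D \<Longrightarrow> g \<in> cox_ring X \<iota> \<xi> r D \<Longrightarrow> f + g \<in> cox_ring X \<iota> \<xi> r D"
  by (auto simp: cox_ring_eq cox_map_add[symmetric] intro!: imageI poly_ring_add)

lemma cox_ring_scale:
  "f \<in> cox_ring X \<iota> \<xi> r D \<Longrightarrow> Poly_Mapping.single 0 (\<iota> c) * f \<in> cox_ring X \<iota> \<xi> r D"
  by (auto simp: cox_ring_eq cox_map_scale[symmetric] intro!: imageI poly_ring_scale)

lemma cox_ring_variable_mult:
  "i < n \<Longrightarrow> f \<in> cox_ring X \<iota> \<xi> r D \<Longrightarrow> Poly_Mapping.single (C i) (x i) * f \<in> cox_ring X \<iota> \<xi> r D"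
  by (auto simp: cox_ring_eq cox_map_variable_mult[symmetric] intro!: imageI poly_ring_variable_mult)

lemma sections_add:
  "d \<in> degree_group r \<Longrightarrow> s \<in> sections d \<Longrightarrow> t \<in> sections d \<Longrightarrow> s + t \<in> sections d"
  using cox_ring_add[of "Poly_Mapping.single d s" "Poly_Mapping.single d t"]
  by (simp add: single_mem_cox_ring_iff flip: single_add)

lemma sections_scale: "d \<in> degree_group r \<Longrightarrow> s \<in> sections d \<Longrightarrow> \<iota> c * s \<in> sections d"
  using cox_ring_scale[of "Poly_Mapping.single d s" c]
  by (simp add: single_mem_cox_ring_iff mult_single)

lemma sections_variable:
  "d \<in> degree_group r \<Longrightarrow> i < n \<Longrightarrow> s \<in> sections (d - C i) \<Longrightarrow> x i * s \<in> sections d"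
  using cox_ring_variable_mult[of i "Poly_Mapping.single (d - C i) s"]
  by (simp add: single_mem_cox_ring_iff mult_single degree_group_diff C_mem)

lemma graded_module_sections:
  "graded_module (\<lambda>c s. \<iota> c * s) (degree_group r) n C (\<lambda>i s. x i * s) sections"
proof -
  interpret vector_space "\<lambda>c s. \<iota> c * s"
    by unfold_locales (simp_all add: iota_add iota_mult iota_1 algebra_simps)
  show ?thesis
  proof
    show "subspace (sections d)" if "d \<in> degree_group r" for d
      using that by (intro subspaceI sections_0 sections_add sections_scale)
  qed (simp_all add: distrib_left mult.left_commute C_mem degree_group_diff sections_variable)
qed

subsection \<open>The complex of sections\<close>

lemma vector_space_section_scale: "vector_space (section_scale \<iota>)"
  by unfold_locales
    (auto intro!: poly_mapping_eqI
      simp: section_scale_def lookup_map_zero lookup_add iota_add iota_mult iota_1 algebra_simps)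

lemma lookup_section_scale: "lookup (section_scale \<iota> c a) S = \<iota> c * lookup a S"
  by (simp add: section_scale_def lookup_map_zero)

lemma section_diff_superset:
  assumes "finite U" "keys a \<subseteq> U"
  shows "section_diff x a = (\<Sum>S\<in>U. \<Sum>i\<in>S. Poly_Mapping.single (S - {i})
     ((-1) ^ (card {l \<in> S. l \<le> i} + 1) * (lookup a S * x i)))"
  unfolding section_diff_def
  by (rule sum.mono_neutral_left) (use assms in \<open>auto simp: in_keys_iff intro!: sum.neutral\<close>)

lemma linear_section_diff: "Vector_Spaces.linear (section_scale \<iota>) (section_scale \<iota>) (section_diff x)"
proof -
  interpret vector_space "section_scale \<iota>" by (rule vector_space_section_scale)
  define e :: "nat set \<Rightarrow> nat \<Rightarrow> 'K" where "e S i = (-1) ^ (card {l \<in> S. l \<le> i} + 1)" for S i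
  have expand: "section_diff x a = (\<Sum>S\<in>U. \<Sum>i\<in>S. Poly_Mapping.single (S - {i}) (e S i * (lookup a S * x i)))"
    if "finite U" "keys a \<subseteq> U" for U a
    unfolding e_def using that by (rule section_diff_superset)
  show ?thesis
  proof
    fix a b :: "nat set \<Rightarrow>\<^sub>0 'K"
    let ?U = "keys a \<union> keys b"
    have "keys (a + b) \<subseteq> ?U" by (rule Poly_Mapping.keys_add)
    then show "section_diff x (a + b) = section_diff x a + section_diff x b"
      by (simp add: expand[of ?U] lookup_add distrib_left distrib_right single_add sum.distrib)
    fix c
    have "keys (section_scale \<iota> c a) \<subseteq> keys a" by (auto simp: in_keys_iff lookup_section_scale)
    then have "section_diff x (section_scale \<iota> c a) = (\<Sum>S\<in>keys a. \<Sum>i\<in>S. Poly_Mapping.single (S - {i})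
        (e S i * (\<iota> c * lookup a S * x i)))"
      by (simp add: expand[of "keys a"] lookup_section_scale)
    also have "\<dots> = section_scale \<iota> c (section_diff x a)"
      by (rule poly_mapping_eqI)
        (simp add: expand[of "keys a"] lookup_section_scale lookup_sum lookup_single when_def
          sum_distrib_left if_distrib mult_ac cong: if_cong)
    finally show "section_diff x (section_scale \<iota> c a) = section_scale \<iota> c (section_diff x a)" .
  qed
qed

lemma lookup_section_diff:
  assumes a: "\<And>S. S \<in> keys a \<Longrightarrow> S \<subseteq> {..<n}"
  shows "lookup (section_diff x a) T = koszul_diff n (\<lambda>i s. x i * s) (lookup a) T"
proof -
  define g where "g S i = (-1) ^ (card {l \<in> S. l \<le> i} + 1) * (lookup a S * x i)" for S i
  have fin: "finite S" if "S \<in> keys a" for S using a[OF that] finite_subset by blast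
  have "lookup (section_diff x a) T = (\<Sum>S\<in>keys a. \<Sum>i\<in>S. if S - {i} = T then g S i else 0)"
    unfolding section_diff_def lookup_sum lookup_single when_def g_def ..
  also have "\<dots> = (\<Sum>(S, i)\<in>(SIGMA S:keys a. S). if S - {i} = T then g S i else 0)"
    by (rule sum.Sigma) (use fin in auto)
  also have "\<dots> = (\<Sum>(S, i)\<in>{(S, i). S \<in> keys a \<and> i \<in> S \<and> S - {i} = T}. g S i)"
    using fin by (intro sum.mono_neutral_cong_right) (auto split: if_splits)
  also have "\<dots> = (\<Sum>i\<in>{i \<in> {..<n} - T. insert i T \<in> keys a}. g (insert i T) i)"
    by (rule sum.reindex_bij_witness[of _ "\<lambda>i. (insert i T, i)" snd])
      (use a[THEN subsetD] in \<open>auto simp: insert_absorb insert_Diff\<close>)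
  also have "\<dots> = (\<Sum>i\<in>{..<n} - T. g (insert i T) i)"
    by (rule sum.mono_neutral_left) (auto simp: in_keys_iff g_def)
  also have "\<dots> = koszul_diff n (\<lambda>i s. x i * s) (lookup a) T"
    unfolding koszul_diff_def
  proof (rule sum.cong[OF refl])
    fix i assume i: "i \<in> {..<n} - T"
    have "{l \<in> insert i T. l \<le> i} = insert i {l \<in> T. l < i}" using i by auto
    then have "card {l \<in> insert i T. l \<le> i} = Suc (card {l \<in> T. l < i})" using i by simp
    then show "g (insert i T) i = signed (card {l \<in> T. l < i}) (x i * lookup a (insert i T))"
      by (simp add: g_def signed_def mult.commute)
  qed
  finally show ?thesis .
qed

lemma mem_section_complex_iff:
  assumes m: "m \<in> degree_group r"
  shows "a \<in> section_complex X \<iota> \<xi> r D n C m j \<longleftrightarrow> lookup a \<in> koszul_chains n C sections m j"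
proof -
  interpret graded_module "\<lambda>c s. \<iota> c * s" "degree_group r" n C "\<lambda>i s. x i * s" sections
    by (rule graded_module_sections)
  have "(lookup a S \<noteq> 0 \<longrightarrow> S \<subseteq> {..<n} \<and> card S = j \<and> lookup a S \<in> sections (m - sum C S))
    \<longleftrightarrow> (if S \<subseteq> {..<n} \<and> card S = j then lookup a S \<in> sections (m - sum C S) else lookup a S = 0)" for S
    using sections_0[OF degree_diff_sum[OF m, of S]] by (cases "lookup a S = 0") auto
  then show ?thesis
    unfolding section_complex_def koszul_chains_def sections_def[symmetric] in_keys_iff Ball_def mem_Collect_eq
    by (simp only:)
qed

lemma lookup_section_diff_chain:
  assumes m: "m \<in> degree_group r" and a: "a \<in> section_complex X \<iota> \<xi> r D n C m j"
  shows "lookup (section_diff x a) = koszul_diff n (\<lambda>i s. x i * s) (lookup a)"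
  using a by (intro ext lookup_section_diff) (auto simp: section_complex_def)

theorem vs_complex_section_complex:
  assumes m: "m \<in> degree_group r"
  shows "vs_complex (section_scale \<iota>) (section_complex X \<iota> \<xi> r D n C m) (section_diff x)"
proof -
  interpret K: graded_module "\<lambda>c s. \<iota> c * s" "degree_group r" n C "\<lambda>i s. x i * s" sections
    by (rule graded_module_sections)
  interpret vector_space "section_scale \<iota>" by (rule vector_space_section_scale)
  note mem = mem_section_complex_iff[OF m] and diff = lookup_section_diff_chain[OF m]
  show ?thesis
    unfolding vs_complex_def
  proof (intro conjI allI ballI)
    show "subspace (section_complex X \<iota> \<xi> r D n C m j)" for j
    proof (rule subspaceI)
      show "0 \<in> section_complex X \<iota> \<xi> r D n C m j" by (simp add: section_complex_def)
      fix a b c assume a: "a \<in> section_complex X \<iota> \<xi> r D n C m j"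
      then show "section_scale \<iota> c a \<in> section_complex X \<iota> \<xi> r D n C m j"
        unfolding mem using K.chains_scale[OF m, of "lookup a" j c]
        by (simp add: pointwise_scale_def lookup_section_scale[abs_def] fun_eq_iff)
      assume b: "b \<in> section_complex X \<iota> \<xi> r D n C m j"
      \<comment> \<open>The sum is obtained from closure under differences.\<close>
      have "0 - lookup b \<in> koszul_chains n C sections m j"
        using K.chains_diff[OF m] b unfolding mem by (metis diff_self)
      then have "lookup a - (0 - lookup b) \<in> koszul_chains n C sections m j"
        using K.chains_diff[OF m] a unfolding mem by blast
      moreover have "lookup a - (0 - lookup b) = lookup (a + b)" by (simp add: fun_eq_iff lookup_add)
      ultimately show "a + b \<in> section_complex X \<iota> \<xi> r D n C m j" unfolding mem by simp
    qed
    show "Vector_Spaces.linear (section_scale \<iota>) (section_scale \<iota>) (section_diff x)"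
      by (rule linear_section_diff)
    have zero: "section_diff x a = 0" if "a \<in> section_complex X \<iota> \<xi> r D n C m 0" for a
      using K.koszul_diff_chains_0 diff[OF that] that unfolding mem
      by (intro poly_mapping_eqI) (simp add: fun_eq_iff)
    have "0 \<in> section_complex X \<iota> \<xi> r D n C m 0" by (simp add: section_complex_def)
    then show "section_diff x ` section_complex X \<iota> \<xi> r D n C m 0 = {0}" using zero by force
    have dmem: "section_diff x a \<in> section_complex X \<iota> \<xi> r D n C m j"
      if "a \<in> section_complex X \<iota> \<xi> r D n C m (Suc j)" for a j
      using K.koszul_diff_mem[OF m] diff[OF that] that unfolding mem by simp
    then show "section_diff x ` section_complex X \<iota> \<xi> r D n C m (Suc j)
        \<subseteq> section_complex X \<iota> \<xi> r D n C m j" for j by blast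
    fix j a assume a: "a \<in> section_complex X \<iota> \<xi> r D n C m j"
    show "section_diff x (section_diff x a) = 0"
    proof (cases j)
      case 0
      then show ?thesis using zero a by (simp add: section_diff_def)
    next
      case (Suc k)
      then show ?thesis
        using diff[OF dmem[of a k]] diff[OF a] a K.koszul_diff_koszul_diff
        by (intro poly_mapping_eqI) (simp add: fun_eq_iff)
    qed
  qed
qed

text \<open>Passing from finitely supported functions to arbitrary ones changes nothing, since the sets of
  indices of a chain are subsets of a finite set.\<close>

theorem section_homology_koszul:
  assumes m: "m \<in> degree_group r"
  shows "isomorphic_quotients (section_scale \<iota>)
      {a \<in> section_complex X \<iota> \<xi> r D n C m i. section_diff x a = 0}
      (section_diff x ` section_complex X \<iota> \<xi> r D n C m (Suc i))
    (pointwise_scale (\<lambda>c s. \<iota> c * s)) (koszul_cycles n C (\<lambda>i s. x i * s) sections m i)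
      (koszul_boundaries n C (\<lambda>i s. x i * s) sections m i)" (is "isomorphic_quotients _ ?V ?W _ ?V' ?W'")
proof -
  note mem = mem_section_complex_iff[OF m] and diff = lookup_section_diff_chain[OF m]
  have chain: "\<exists>a. lookup a = c \<and> a \<in> section_complex X \<iota> \<xi> r D n C m j"
    if c: "c \<in> koszul_chains n C sections m j" for c j
  proof -
    have "{S. c S \<noteq> 0} \<subseteq> Pow {..<n}" using c unfolding koszul_chains_def by (auto split: if_splits)
    then have "finite {S. c S \<noteq> 0}" using finite_subset by blast
    then have "lookup (Abs_poly_mapping c) = c" by (rule lookup_Abs_poly_mapping)
    then show ?thesis using c unfolding mem by metis
  qed
  have cycle: "a \<in> ?V \<longleftrightarrow> lookup a \<in> ?V'" for a
  proof -
    have "section_diff x a = 0 \<longleftrightarrow> koszul_diff n (\<lambda>i s. x i * s) (lookup a) = 0"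
      if "a \<in> section_complex X \<iota> \<xi> r D n C m i"
      unfolding diff[OF that, symmetric] by (simp add: poly_mapping_eq_iff fun_eq_iff)
    then show ?thesis unfolding koszul_cycles_def mem_Collect_eq mem[symmetric] by blast
  qed
  have boundary: "a \<in> ?W \<longleftrightarrow> lookup a \<in> ?W'" for a
  proof
    assume "a \<in> ?W"
    then show "lookup a \<in> ?W'" using diff mem unfolding koszul_boundaries_def by blast
  next
    assume "lookup a \<in> ?W'"
    then obtain c where c: "c \<in> koszul_chains n C sections m (Suc i)"
      "lookup a = koszul_diff n (\<lambda>i s. x i * s) c" unfolding koszul_boundaries_def by blast
    obtain b where b: "lookup b = c" "b \<in> section_complex X \<iota> \<xi> r D n C m (Suc i)"
      using chain[OF c(1)] by blast
    then have "a = section_diff x b" using diff[OF b(2)] c(2) by (simp add: poly_mapping_eq_iff)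
    then show "a \<in> ?W" using b by blast
  qed
  interpret K: graded_module "\<lambda>c s. \<iota> c * s" "degree_group r" n C "\<lambda>i s. x i * s" sections
    by (rule graded_module_sections)
  have "linear_correspondence (section_scale \<iota>) ?V ?W (pointwise_scale (\<lambda>c s. \<iota> c * s)) ?V' ?W'
      (\<lambda>a c. a \<in> ?V \<and> c = lookup a)"
    unfolding linear_correspondence_def
  proof (intro conjI allI impI ballI; (elim conjE)?)
    fix a c b d assume "a \<in> ?V" "c = lookup a" "b \<in> ?V" "d = lookup b"
    moreover show "c - d = lookup (a - b)" using calculation by (simp add: fun_eq_iff lookup_minus)
    ultimately have "lookup (a - b) \<in> ?V'"
      unfolding cycle koszul_cycles_def using K.chains_diff[OF m]
      by (metis (mono_tags, lifting) K.koszul_diff_diff diff_self mem_Collect_eq)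
    then show "a - b \<in> ?V" unfolding cycle .
  next
    fix t a c assume "a \<in> ?V" "c = lookup a"
    moreover show "pointwise_scale (\<lambda>c s. \<iota> c * s) t c = lookup (section_scale \<iota> t a)"
      using calculation by (simp add: fun_eq_iff pointwise_scale_def lookup_section_scale)
    ultimately have "lookup (section_scale \<iota> t a) \<in> ?V'"
      unfolding cycle koszul_cycles_def using K.chains_scale[OF m]
      by (metis (mono_tags, lifting) K.koszul_diff_scale K.pointwise_scale_0 mem_Collect_eq)
    then show "section_scale \<iota> t a \<in> ?V" unfolding cycle .
  next
    fix c assume c: "c \<in> ?V'"
    then show "\<exists>a. a \<in> ?V \<and> c = lookup a"
      using chain[of c i] cycle unfolding koszul_cycles_def by (metis (no_types, lifting) mem_Collect_eq)
  qed (use cycle boundary in auto)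
  then show ?thesis unfolding isomorphic_quotients_def by blast
qed

end


section \<open>Syzygies of a minimal resolution of the Cox ring\<close>

locale cox_resolution = presented_cox_ring X \<iota> \<xi> r D n C x
  for X :: "('v::finite \<Rightarrow> 'k::alg_closed_field) set"
    and \<iota> :: "'k \<Rightarrow> 'K::field" and \<xi> :: "'v \<Rightarrow> 'K"
    and r :: nat and D :: "nat \<Rightarrow> ('v \<Rightarrow> 'k) \<Rightarrow> 'K"
    and n :: nat and C :: "nat \<Rightarrow> nat \<Rightarrow>\<^sub>0 int" and x :: "nat \<Rightarrow> 'K" +
  fixes rank :: "nat \<Rightarrow> nat" and shift :: "nat \<Rightarrow> nat \<Rightarrow> nat \<Rightarrow>\<^sub>0 int"
    and diff :: "nat \<Rightarrow> (nat \<Rightarrow>\<^sub>0 (nat, 'k) mpoly) \<Rightarrow> (nat \<Rightarrow>\<^sub>0 (nat, 'k) mpoly)"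
    and aug :: "(nat \<Rightarrow>\<^sub>0 (nat, 'k) mpoly) \<Rightarrow> (nat \<Rightarrow>\<^sub>0 int) \<Rightarrow>\<^sub>0 'K"
  assumes resolution: "minimal_graded_free_resolution r n C (cox_ring X \<iota> \<xi> r D)
    (\<lambda>p f. cox_map \<iota> C x p * f) (cox_piece X \<iota> \<xi> r D) rank shift diff aug"
begin

abbreviation F :: "nat \<Rightarrow> (nat \<Rightarrow>\<^sub>0 (nat, 'k) mpoly) set"
  where "F i \<equiv> free_module n (rank i)"
abbreviation piece :: "nat \<Rightarrow> (nat \<Rightarrow>\<^sub>0 int) \<Rightarrow> (nat \<Rightarrow>\<^sub>0 (nat, 'k) mpoly) set"
  where "piece i \<equiv> free_piece n C (rank i) (shift i)"

lemma shift_mem: "j < rank i \<Longrightarrow> shift i j \<in> degree_group r"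
  and aug_add: "f \<in> F 0 \<Longrightarrow> g \<in> F 0 \<Longrightarrow> aug (f + g) = aug f + aug g"
  and aug_mult: "p \<in> poly_ring n \<Longrightarrow> f \<in> F 0 \<Longrightarrow>
    aug (Poly_Mapping.map ((*) p) f) = cox_map \<iota> C x p * aug f"
  and aug_piece: "d \<in> degree_group r \<Longrightarrow> f \<in> piece 0 d \<Longrightarrow> aug f \<in> cox_piece X \<iota> \<xi> r D d"
  and diff_add: "f \<in> F (Suc i) \<Longrightarrow> g \<in> F (Suc i) \<Longrightarrow> diff i (f + g) = diff i f + diff i g"
  and diff_mult: "p \<in> poly_ring n \<Longrightarrow> f \<in> F (Suc i) \<Longrightarrow>
    diff i (Poly_Mapping.map ((*) p) f) = Poly_Mapping.map ((*) p) (diff i f)"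
  and diff_piece: "d \<in> degree_group r \<Longrightarrow> f \<in> piece (Suc i) d \<Longrightarrow> diff i f \<in> piece i d"
  and aug_image: "aug ` F 0 = cox_ring X \<iota> \<xi> r D"
  and aug_kernel: "{f \<in> F 0. aug f = 0} = diff 0 ` F (Suc 0)"
  and diff_kernel: "{f \<in> F (Suc i). diff i f = 0} = diff (Suc i) ` F (Suc (Suc i))"
  and diff_irrelevant: "f \<in> F (Suc i) \<Longrightarrow> lookup (diff i f) j \<in> irrelevant_ideal n"
  using resolution unfolding minimal_graded_free_resolution_def Let_def linear_map_on_def
  by (auto simp: image_subset_iff)

lemma piece_F: "f \<in> piece i d \<Longrightarrow> f \<in> F i"
  using free_piece_subset by blast

lemma piece_0: "0 \<in> piece i d" and piece_add: "f \<in> piece i d \<Longrightarrow> g \<in> piece i d \<Longrightarrow> f + g \<in> piece i d"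
  and piece_diff: "f \<in> piece i d \<Longrightarrow> g \<in> piece i d \<Longrightarrow> f - g \<in> piece i d"
proof -
  interpret vector_space "free_scale :: 'k \<Rightarrow> _" by (rule vector_space_free_scale)
  have sub: "subspace (piece i d)" by (rule subspace_free_piece)
  show "0 \<in> piece i d" by (rule subspace_0[OF sub])
  show "f \<in> piece i d \<Longrightarrow> g \<in> piece i d \<Longrightarrow> f + g \<in> piece i d" by (rule subspace_add[OF sub])
  show "f \<in> piece i d \<Longrightarrow> g \<in> piece i d \<Longrightarrow> f - g \<in> piece i d" by (rule subspace_diff[OF sub])
qed

lemma aug_0: "aug 0 = 0"
  using aug_add[OF piece_F piece_F, OF piece_0 piece_0] by (metis add.right_neutral add_left_imp_eq)

lemma diff_0: "diff i 0 = 0"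
  using diff_add[OF piece_F piece_F, OF piece_0 piece_0] by (metis add.right_neutral add_left_imp_eq)

lemma aug_diff: "f \<in> piece 0 d \<Longrightarrow> g \<in> piece 0 d \<Longrightarrow> aug (f - g) = aug f - aug g"
  using aug_add[OF piece_F piece_F, of "f - g" d g d] piece_diff[of f 0 d g] by (simp add: algebra_simps)

lemma diff_diff: "f \<in> piece (Suc i) d \<Longrightarrow> g \<in> piece (Suc i) d \<Longrightarrow> diff i (f - g) = diff i f - diff i g"
  using diff_add[OF piece_F piece_F, of "f - g" i d g d] piece_diff[of f "Suc i" d g]
  by (simp add: algebra_simps)

lemma aug_scale: "f \<in> F 0 \<Longrightarrow> aug (free_scale c f) = Poly_Mapping.single 0 (\<iota> c) * aug f"
  unfolding free_scale_def by (simp add: aug_mult poly_ring_constant cox_map_constant)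

lemma aug_variable: "f \<in> F 0 \<Longrightarrow> i < n \<Longrightarrow> aug (free_variable i f) = Poly_Mapping.single (C i) (x i) * aug f"
  unfolding free_variable_def by (simp add: aug_mult poly_ring_variable cox_map_variable)

lemma diff_scale: "f \<in> F (Suc i) \<Longrightarrow> diff i (free_scale c f) = free_scale c (diff i f)"
  unfolding free_scale_def by (simp add: diff_mult poly_ring_constant)

lemma diff_variable: "f \<in> F (Suc i) \<Longrightarrow> j < n \<Longrightarrow> diff i (free_variable j f) = free_variable j (diff i f)"
  unfolding free_variable_def by (simp add: diff_mult poly_ring_variable)

lemma aug_homogeneous:
  assumes "d \<in> degree_group r" "f \<in> piece 0 d"
  obtains s where "s \<in> sections d" "aug f = Poly_Mapping.single d s"
  using aug_piece[OF assms] unfolding cox_piece_def sections_def by blast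

text \<open>The map \<open>aug\<close> preserves degrees, so its value at the component of degree \<open>d\<close> of \<open>g\<close> is the component of
  degree \<open>d\<close> of its value at \<open>g\<close>.\<close>

lemma aug_component:
  assumes d: "d \<in> degree_group r" and g: "g \<in> F 0"
  shows "\<exists>g'\<in>piece 0 d. lookup (aug g') d = lookup (aug g) d"
  using g
proof (induction rule: free_module_induct[where C = C and e = "shift 0" and r = r])
  case (add f g)
  then obtain f' g' where "f' \<in> piece 0 d" "g' \<in> piece 0 d"
    "lookup (aug f') d = lookup (aug f) d" "lookup (aug g') d = lookup (aug g) d" by blast
  then show ?case
    using add.hyps by (intro bexI[of _ "f' + g'"]) (simp_all add: aug_add piece_F piece_add lookup_add)
next
  case (homogeneous e f)
  show ?case
  proof (cases "e = d")
    case False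
    then have "lookup (aug f) d = 0"
      using aug_homogeneous[OF homogeneous] by (metis lookup_single_not_eq)
    then show ?thesis by (intro bexI[of _ 0]) (simp_all add: aug_0 piece_0)
  qed (use homogeneous in blast)
qed (use piece_0 C_mem shift_mem in auto)

text \<open>The maps \<open>diff i\<close> preserve degrees as well. The coefficient of \<open>diff i g\<close> at the monomial \<open>m\<close> of the
  \<open>j\<close>-th generator has degree \<open>monom_degree C m + shift i j\<close>, so the right hand side is its component of degree \<open>d\<close>.\<close>

lemma diff_component:
  assumes d: "d \<in> degree_group r" and g: "g \<in> F (Suc i)"
  shows "\<exists>g'\<in>piece (Suc i) d. \<forall>j m. lookup (lookup (diff i g') j) m
    = (if monom_degree C m + shift i j = d then lookup (lookup (diff i g) j) m else 0)"
  using g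
proof (induction rule: free_module_induct[where C = C and e = "shift (Suc i)" and r = r])
  case (add f g)
  then obtain f' g' where "f' \<in> piece (Suc i) d" "g' \<in> piece (Suc i) d"
    "\<forall>j m. lookup (lookup (diff i f') j) m
      = (if monom_degree C m + shift i j = d then lookup (lookup (diff i f) j) m else 0)"
    "\<forall>j m. lookup (lookup (diff i g') j) m
      = (if monom_degree C m + shift i j = d then lookup (lookup (diff i g) j) m else 0)" by blast
  then show ?case
    using add.hyps by (intro bexI[of _ "f' + g'"]) (simp_all add: diff_add piece_F piece_add lookup_add)
next
  case (homogeneous e f)
  have "monom_degree C m + shift i j = e" if "lookup (lookup (diff i f) j) m \<noteq> 0" for j m
    using diff_piece[OF homogeneous] that unfolding mem_free_piece_iff by (metis diff_add_cancel)
  then show ?case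
    using homogeneous(2)
    by (cases "e = d") (fastforce intro!: bexI[of _ f], fastforce intro!: bexI[of _ 0] simp: diff_0 piece_0)
next
  case zero
  show ?case by (intro bexI[of _ 0]) (simp_all add: diff_0 piece_0)
qed (use C_mem shift_mem in auto)

text \<open>The kernel in the \<open>i\<close>-th step, that is, the syzygy module numbered \<open>i + 1\<close> if the Cox ring itself
  has number 0.\<close>

definition syzygies :: "nat \<Rightarrow> (nat \<Rightarrow>\<^sub>0 int) \<Rightarrow> (nat \<Rightarrow>\<^sub>0 (nat, 'k) mpoly) set" where
  "syzygies i d = {f \<in> piece i d. case i of 0 \<Rightarrow> lookup (aug f) d = 0 | Suc k \<Rightarrow> diff k f = 0}"

lemma mem_syzygies_iff:
  assumes d: "d \<in> degree_group r"
  shows "f \<in> syzygies i d \<longleftrightarrow> f \<in> piece i d \<and> f \<in> diff i ` F (Suc i)"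
proof (cases i)
  case 0
  have "aug f = 0 \<longleftrightarrow> lookup (aug f) d = 0" if "f \<in> piece 0 d"
    using aug_homogeneous[OF d that] by (metis lookup_single_eq lookup_zero single_zero)
  then show ?thesis using 0 piece_F[of f 0 d] by (auto simp: syzygies_def aug_kernel[symmetric])
next
  case (Suc k)
  then show ?thesis using piece_F[of f i d] by (auto simp: syzygies_def diff_kernel[symmetric])
qed

text \<open>Exactness passes to the pieces: a homogeneous image is the image of a homogeneous element, namely of the
  component of matching degree of any preimage.\<close>

lemma diff_image:
  assumes d: "d \<in> degree_group r"
  shows "diff i ` piece (Suc i) d = syzygies i d"
proof
  show "diff i ` piece (Suc i) d \<subseteq> syzygies i d"
    using diff_piece[OF d] piece_F by (auto simp: mem_syzygies_iff[OF d] intro!: imageI)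
  show "syzygies i d \<subseteq> diff i ` piece (Suc i) d"
  proof
    fix f assume "f \<in> syzygies i d"
    then obtain g where f: "f \<in> piece i d" and g: "g \<in> F (Suc i)" "f = diff i g"
      unfolding mem_syzygies_iff[OF d] by blast
    from diff_component[OF d g(1)] obtain g' where g': "g' \<in> piece (Suc i) d"
      "\<And>j m. lookup (lookup (diff i g') j) m
        = (if monom_degree C m + shift i j = d then lookup (lookup f j) m else 0)"
      using g(2) by blast
    have "monom_degree C m + shift i j = d" if "lookup (lookup f j) m \<noteq> 0" for j m
      using f that unfolding mem_free_piece_iff by (metis diff_add_cancel)
    then have "diff i g' = f" by (intro poly_mapping_eqI) (auto simp: g'(2))
    then show "f \<in> diff i ` piece (Suc i) d" using g'(1) by blast
  qed
qed

lemma syzygies_irrelevant: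
  assumes "d \<in> degree_group r" "f \<in> syzygies i d"
  shows "lookup (lookup f j) 0 = 0"
  using assms diff_irrelevant[of _ i j] unfolding mem_syzygies_iff[OF assms(1)]
  by (auto simp: irrelevant_ideal_def)

lemma contractible_piece:
  "contractible_module free_scale (degree_group r) n C free_variable (piece i) free_divide"
  by (rule contractible_free_module) (rule C_mem)

lemma augmentation_surjection:
  "graded_surjection free_scale (\<lambda>c s. \<iota> c * s) (degree_group r) n C free_variable (piece 0)
    (\<lambda>i s. x i * s) sections (\<lambda>d f. lookup (aug f) d)"
proof -
  interpret source: contractible_module free_scale "degree_group r" n C free_variable "piece 0" free_divide
    by (rule contractible_piece)
  interpret target: graded_module "\<lambda>c s. \<iota> c * s" "degree_group r" n C "\<lambda>i s. x i * s" sections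
    by (rule graded_module_sections)
  show ?thesis
  proof
    fix d assume d: "d \<in> degree_group r"
    show "lookup (aug (f - g)) d = lookup (aug f) d - lookup (aug g) d"
      if "f \<in> piece 0 d" "g \<in> piece 0 d" for f g using that by (simp add: aug_diff lookup_minus)
    show "lookup (aug (free_scale c f)) d = \<iota> c * lookup (aug f) d" if "f \<in> piece 0 d" for f c
      using that by (simp add: aug_scale piece_F lookup_scale)
    show "(\<lambda>f. lookup (aug f) d) ` piece 0 d = sections d"
    proof
      show "(\<lambda>f. lookup (aug f) d) ` piece 0 d \<subseteq> sections d"
      proof (rule image_subsetI)
        fix f assume "f \<in> piece 0 d"
        then obtain s where "s \<in> sections d" "aug f = Poly_Mapping.single d s"
          by (rule aug_homogeneous[OF d])
        then show "lookup (aug f) d \<in> sections d" by simp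
      qed
      show "sections d \<subseteq> (\<lambda>f. lookup (aug f) d) ` piece 0 d"
      proof
        fix s assume "s \<in> sections d"
        then have "Poly_Mapping.single d s \<in> aug ` F 0" using d by (simp add: aug_image single_mem_cox_ring_iff)
        then obtain g where g: "g \<in> F 0" "aug g = Poly_Mapping.single d s" by (metis imageE)
        then show "s \<in> (\<lambda>f. lookup (aug f) d) ` piece 0 d"
          using aug_component[OF d g(1)] by auto
      qed
    qed
    show "lookup (aug (free_variable i f)) d = x i * lookup (aug f) (d - C i)"
      if i: "i < n" and f: "f \<in> piece 0 (d - C i)" for i f
    proof -
      have "d - C i \<in> degree_group r" using i by (intro degree_group_diff d C_mem)
      then obtain s where s: "aug f = Poly_Mapping.single (d - C i) s"
        using f by (rule aug_homogeneous)
      then show ?thesis using i f by (simp add: aug_variable piece_F mult_single)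
    qed
  qed
qed

text \<open>The target of each surjection is the kernel of the previous one; its module structure is
  inherited along the resolution.\<close>

lemma syzygy_surjection:
  "graded_surjection free_scale free_scale (degree_group r) n C free_variable (piece (Suc i))
    free_variable (syzygies i) (\<lambda>_. diff i)"
proof (induction i)
  have step: "graded_surjection free_scale free_scale (degree_group r) n C free_variable (piece (Suc i))
      free_variable (syzygies i) (\<lambda>_. diff i)"
    if target: "graded_module free_scale (degree_group r) n C free_variable (syzygies i)" for i
  proof -
    interpret source: contractible_module free_scale "degree_group r" n C free_variable "piece (Suc i)" free_divide
      by (rule contractible_piece)
    interpret target: graded_module free_scale "degree_group r" n C free_variable "syzygies i"
      by (rule target)
    show ?thesis
      by unfold_locales (auto simp: diff_diff diff_scale diff_variable piece_F diff_image)
  qed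
  {
    case 0
    interpret graded_surjection free_scale "\<lambda>c s. \<iota> c * s" "degree_group r" n C free_variable "piece 0"
      "\<lambda>i s. x i * s" sections "\<lambda>d f. lookup (aug f) d"
      by (rule augmentation_surjection)
    have "kernel = syzygies 0" by (simp add: fun_eq_iff kernel_def syzygies_def)
    then show ?case using graded_module_kernel by (intro step) simp
  next
    case (Suc i)
    interpret graded_surjection free_scale free_scale "degree_group r" n C free_variable "piece (Suc i)"
      free_variable "syzygies i" "\<lambda>_. diff i" by (rule Suc)
    have "kernel = syzygies (Suc i)" by (simp add: fun_eq_iff kernel_def syzygies_def)
    then show ?case using graded_module_kernel by (intro step) simp
  }
qed

context
  fixes m assumes m: "m \<in> degree_group r"
begin

lemma piece_acyclic:
  "a \<in> koszul_cycles n C free_variable (piece i) m (Suc j)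
    \<Longrightarrow> a \<in> koszul_boundaries n C free_variable (piece i) m (Suc j)"
  by (rule contractible_module.koszul_acyclic[OF contractible_piece m])

text \<open>For \<open>j = 0\<close> this is minimality, for \<open>j > 0\<close> the acyclicity of the Koszul complex of a free module.\<close>

lemma syzygy_cycles_bound:
  assumes a: "a \<in> koszul_cycles n C free_variable (syzygies i) m j"
  shows "a \<in> koszul_boundaries n C free_variable (piece i) m j"
proof -
  have chain: "a \<in> koszul_chains n C (piece i) m j" and cyc: "koszul_diff n free_variable a = 0"
    using a unfolding koszul_cycles_def koszul_chains_def syzygies_def by (auto split: if_splits)
  show ?thesis
  proof (cases j)
    case 0
    have "a {} \<in> syzygies i m"
      using a 0 unfolding koszul_cycles_def koszul_chains_def by (auto dest!: spec[of _ "{}"])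
    from syzygies_irrelevant[OF m this] show ?thesis
      using chain 0 by (simp add: koszul_boundaries_free_iff[of n C r, OF C_mem m])
  next
    case (Suc k)
    then show ?thesis using chain cyc piece_acyclic by (simp add: koszul_cycles_def)
  qed
qed

text \<open>Dimension shifting along the resolution, one connecting isomorphism for each step.\<close>

lemma koszul_sections_syzygies:
  "isomorphic_quotients
    (pointwise_scale (\<lambda>c s. \<iota> c * s)) (koszul_cycles n C (\<lambda>i s. x i * s) sections m (Suc (i + j)))
      (koszul_boundaries n C (\<lambda>i s. x i * s) sections m (Suc (i + j)))
    (pointwise_scale free_scale) (koszul_cycles n C free_variable (syzygies i) m j)
      (koszul_boundaries n C free_variable (syzygies i) m j)"
proof (induction i arbitrary: j)
  case 0
  interpret graded_surjection free_scale "\<lambda>c s. \<iota> c * s" "degree_group r" n C free_variable "piece 0"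
    "\<lambda>i s. x i * s" sections "\<lambda>d f. lookup (aug f) d"
    by (rule augmentation_surjection)
  have kernel: "kernel = syzygies 0" by (simp add: fun_eq_iff kernel_def syzygies_def)
  show ?case
    using connecting_isomorphism[OF m, unfolded kernel, OF piece_acyclic syzygy_cycles_bound] by simp
next
  case (Suc i)
  interpret graded_surjection free_scale free_scale "degree_group r" n C free_variable "piece (Suc i)"
    free_variable "syzygies i" "\<lambda>_. diff i" by (rule syzygy_surjection)
  have kernel: "kernel = syzygies (Suc i)" by (simp add: fun_eq_iff kernel_def syzygies_def)
  show ?case
    using isomorphic_quotients_trans[OF Suc.IH[of "Suc j"]
      connecting_isomorphism[OF m, unfolded kernel, OF piece_acyclic syzygy_cycles_bound]] by simp
qed

lemma koszul_sections_generators: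
  "isomorphic_quotients
    (pointwise_scale (\<lambda>c s. \<iota> c * s)) (koszul_cycles n C (\<lambda>i s. x i * s) sections m i)
      (koszul_boundaries n C (\<lambda>i s. x i * s) sections m i)
    free_scale (piece i m) (irrelevant_piece n C (rank i) (shift i) m)"
proof (rule isomorphic_quotients_trans[OF _ koszul_homology_0_free[of n C r, OF C_mem m]])
  show "isomorphic_quotients
    (pointwise_scale (\<lambda>c s. \<iota> c * s)) (koszul_cycles n C (\<lambda>i s. x i * s) sections m i)
      (koszul_boundaries n C (\<lambda>i s. x i * s) sections m i)
    (pointwise_scale free_scale) (koszul_cycles n C free_variable (piece i) m 0)
      (koszul_boundaries n C free_variable (piece i) m 0)"
  proof (cases i)
    case 0
    interpret graded_surjection free_scale "\<lambda>c s. \<iota> c * s" "degree_group r" n C free_variable "piece 0"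
      "\<lambda>i s. x i * s" sections "\<lambda>d f. lookup (aug f) d"
      by (rule augmentation_surjection)
    have kernel: "kernel = syzygies 0" by (simp add: fun_eq_iff kernel_def syzygies_def)
    show ?thesis
      using augmentation_isomorphism[OF m, unfolded kernel, OF syzygy_cycles_bound] 0 by simp
  next
    case (Suc k)
    interpret graded_surjection free_scale free_scale "degree_group r" n C free_variable "piece (Suc k)"
      free_variable "syzygies k" "\<lambda>_. diff k" by (rule syzygy_surjection)
    have kernel: "kernel = syzygies (Suc k)" by (simp add: fun_eq_iff kernel_def syzygies_def)
    show ?thesis
      using isomorphic_quotients_trans[OF koszul_sections_syzygies[of k 0]
        augmentation_isomorphism[OF m, unfolded kernel, OF syzygy_cycles_bound]] Suc by simp
  qed
qed

text \<open>By the isomorphisms above the homology is \<open>F\<^sub>i / (x\<^sub>1, \<dots>, x\<^sub>n) F\<^sub>i\<close> in degree \<open>m\<close>, with the basis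
  of the generators of degree \<open>m\<close>.\<close>

theorem homology_dim_sections:
  "homology_dim (section_scale \<iota>) (section_complex X \<iota> \<xi> r D n C m) (section_diff x) i
    = enat (multiplicity_in_step rank shift i m)"
proof -
  let ?A = "section_complex X \<iota> \<xi> r D n C m"
  let ?V = "{a \<in> ?A i. section_diff x a = 0}" and ?W = "section_diff x ` ?A (Suc i)"
  have vs: "vector_space (section_scale \<iota>)" by (rule vector_space_section_scale)
  interpret vs: vector_space "section_scale \<iota>" by (rule vs)
  interpret lin: Vector_Spaces.linear "section_scale \<iota>" "section_scale \<iota>" "section_diff x"
    by (rule linear_section_diff)
  have "vs.subspace (?A (Suc i))"
    using vs_complex_section_complex[OF m] unfolding vs_complex_def by blast
  then have W: "vs.subspace ?W" by (rule lin.subspace_image)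
  interpret free: vector_space "free_scale :: 'k \<Rightarrow> _" by (rule vector_space_free_scale)
  have irr: "free.subspace (irrelevant_piece n C (rank i) (shift i) m :: (nat \<Rightarrow>\<^sub>0 (nat, 'k) mpoly) set)"
  proof (rule free.subspaceI)
    have sub: "free.subspace (piece i m)" by (rule subspace_free_piece)
    show "(0 :: nat \<Rightarrow>\<^sub>0 (nat, 'k) mpoly) \<in> irrelevant_piece n C (rank i) (shift i) m"
      by (simp add: irrelevant_piece_def piece_0)
    fix f g :: "nat \<Rightarrow>\<^sub>0 (nat, 'k) mpoly" and c
    assume f: "f \<in> irrelevant_piece n C (rank i) (shift i) m"
    then show "free_scale c f \<in> irrelevant_piece n C (rank i) (shift i) m"
      using free.subspace_scale[OF sub] by (simp add: irrelevant_piece_def lookup_free_scale lookup_scale)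
    assume "g \<in> irrelevant_piece n C (rank i) (shift i) m"
    with f show "f + g \<in> irrelevant_piece n C (rank i) (shift i) m"
      by (simp add: irrelevant_piece_def piece_add lookup_add)
  qed
  have "isomorphic_quotients (section_scale \<iota>) ?V ?W
      free_scale (piece i m) (irrelevant_piece n C (rank i) (shift i) m)"
    by (rule isomorphic_quotients_trans[OF section_homology_koszul[OF m] koszul_sections_generators])
  from basis_modulo_pullback[OF this basis_modulo_irrelevant_piece vector_space_free_scale irr] piece_0
  obtain B where "basis_modulo (section_scale \<iota>) ?V ?W B"
    "card B = card {j. j < rank i \<and> shift i j = m}"
    unfolding card_basis_irrelevant_piece by blast
  then show ?thesis
    using quotient_dim_eq[OF vs W] unfolding homology_dim_def multiplicity_in_step_def by simp
qed

end

end

theorem lemma2p2: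
  fixes X :: "('v::finite \<Rightarrow> 'k::alg_closed_field) set"
    and \<iota> :: "'k \<Rightarrow> 'K::field" and \<xi> :: "'v \<Rightarrow> 'K"
    and r :: nat and D :: "nat \<Rightarrow> ('v \<Rightarrow> 'k) \<Rightarrow> 'K"
    and n :: nat and C :: "nat \<Rightarrow> nat \<Rightarrow>\<^sub>0 int" and x :: "nat \<Rightarrow> 'K"
    and m :: "nat \<Rightarrow>\<^sub>0 int"
  assumes "projective_variety X" and "generic_point X \<iota> \<xi>" and "smooth_variety X \<iota> \<xi>"
    and "pic_basis X \<iota> \<xi> r D" and "\<forall>i<r. effective_divisor X \<iota> \<xi> (D i)"
    and "cox_presentation X \<iota> \<xi> r D n C x"
    and "m \<in> degree_group r"
  shows "vs_complex (section_scale \<iota>) (section_complex X \<iota> \<xi> r D n C m) (section_diff x) \<and>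
    (\<forall>rank shift diff aug.
       minimal_graded_free_resolution r n C (cox_ring X \<iota> \<xi> r D) (\<lambda>p f. cox_map \<iota> C x p * f)
         (cox_piece X \<iota> \<xi> r D) rank shift diff aug \<longrightarrow>
       (\<forall>i. enat (multiplicity_in_step rank shift i m) =
          homology_dim (section_scale \<iota>) (section_complex X \<iota> \<xi> r D n C m) (section_diff x) i))"
proof -
  interpret presented_cox_ring X \<iota> \<xi> r D n C x
    using assms unfolding generic_point_def by unfold_locales auto
  show ?thesis
  proof (intro conjI allI impI)
    show "vs_complex (section_scale \<iota>) (section_complex X \<iota> \<xi> r D n C m) (section_diff x)"
      by (rule vs_complex_section_complex[OF assms(7)])
    fix rank shift diff aug i
    assume "minimal_graded_free_resolution r n C (cox_ring X \<iota> \<xi> r D) (\<lambda>p f. cox_map \<iota> C x p * f)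
         (cox_piece X \<iota> \<xi> r D) rank shift diff aug"
    then interpret cox_resolution X \<iota> \<xi> r D n C x rank shift diff aug by unfold_locales
    show "enat (multiplicity_in_step rank shift i m) =
        homology_dim (section_scale \<iota>) (section_complex X \<iota> \<xi> r D n C m) (section_diff x) i"
      by (rule homology_dim_sections[OF assms(7), symmetric])
  qed
qed

end
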